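(* Let $\mathcal R_{\mathrm{DFA}}$ be the DFA encoding system and let $\mathcal C_{\mathrm{DFA}}$ be the complexity measure returning the number of states of a DFA. Then the class of regular languages over $\{0,1\}$, $\mathcal F^{\mathcal R_{\mathrm{DFA}}}$, admits non-asymptotic length generalization w.r.t. $\mathcal R_{\mathrm{DFA}}$ and $\mathcal C_{\mathrm{DFA}}$. More specifically, there exists a learning algorithm $\mathcal A$ such that $N^{\mathcal R_{\mathrm{DFA}}}_{\mathcal A}(c)\le 2c-2$ for all integers $c\ge1$.
   Context: Strings are over $\{0,1\}$; $\{0,1\}^*$ contains the empty string. An $n$-state DFA is $M=(Q=[n],\Sigma=\{0,1\},\delta,q_0,F)$ with (total) transition function $\delta:Q\times\Sigma\to Q$, start state $q_0$, and accepting set $F\subseteq Q$. $\langle M\rangle\in\{0,1\}^*$ is a binary encoding of $M$. The encoding system $\mathcal R=\mathcal R_{\mathrm{DFA}}$ maps $\langle M\rangle$ to (a Turing machine computing) the function $\mathcal R(\langle M\rangle):\{0,1\}^*\to\{0,1\}$ which is the indicator of the language accepted by $M$; strings that encode no DFA are mapped to the empty language. $\mathcal F^{\mathcal R}=\{\mathcal R(p):p\in\{0,1\}^*\}$. The complexity measure is $\mathcal C(\langle M\rangle)=n$, the number of states, and for $f\in\mathcal F^{\mathcal R}$, $\mathcal C^{\mathcal R}(f)=\min\{\mathcal C(p):\mathcal R(p)=f\}$, i.e. the minimum number of states of a DFA for $f$. Training data: $D_N(f)=\{(x,f(x)):x\in\{0,1\}^*,|x|\le N\}$. A learning algorithm is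 a Turing machine $\mathcal A$ that takes a training set $D_N(f)$ and outputs a string. $N^{\mathcal R}_{\mathcal A}(f)=\min\{N\ge 0:\forall n\ge N,\ \mathcal R(\mathcal A(D_n(f)))=f\}$ ($\infty$ if none), and $N^{\mathcal R}_{\mathcal A}(c)=\max\{N^{\mathcal R}_{\mathcal A}(f): f\in\mathcal F^{\mathcal R},\ \mathcal C^{\mathcal R}(f)\le c\}$. $\mathcal F^{\mathcal R}$ admits non-asymptotic length generalization w.r.t. $\mathcal R,\mathcal C$ if there exist a learning algorithm $\mathcal A$ and a computable $\hat N:\mathbb N\to\mathbb N$ such that for all $f\in\mathcal F^{\mathcal R}$ and all $N'\ge\hat N(\mathcal C^{\mathcal R}(f))$, $\mathcal R(\mathcal A(D_{N'}(f)))=f$. *)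

theory Defs
  imports
    "HOL-Library.Extended_Nat"
    "HOL-Library.List_Lenlexorder"
    "HOL-Library.Product_Lexorder"
begin

section \<open>Turing machines\<close>

text \<open>
  Deterministic Turing machines with finitely many two-way infinite tapes. The states are
  \<open>0, \<dots>, ctrl M\<close>, where \<open>0\<close> is initial and \<open>ctrl M\<close> is the halting state; the tape symbols are
  \<open>0, \<dots>, syms M - 1\<close>, where \<open>0\<close> is the blank. Only the finite part of \<open>trans M\<close> that is
  constrained in \<open>is_tm\<close> is ever consulted in a run on an input over the tape symbols.
\<close>

datatype move = Lft | Stay | Rgt

record tm =
  tapes :: nat
  ctrl :: nat
  syms :: nat
  trans :: "nat \<Rightarrow> nat list \<Rightarrow> nat \<times> (nat \<times> move) list"

text \<open>Every machine has at least the blank, the two bits and the separator as tape symbols.\<close>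

definition is_tm :: "tm \<Rightarrow> bool" where
  "is_tm M \<longleftrightarrow> tapes M \<ge> 1 \<and> syms M \<ge> 4 \<and>
     (\<forall>s < ctrl M. \<forall>rs. length rs = tapes M \<and> set rs \<subseteq> {..<syms M} \<longrightarrow>
        fst (trans M s rs) \<le> ctrl M \<and>
        length (snd (trans M s rs)) = tapes M \<and>
        fst ` set (snd (trans M s rs)) \<subseteq> {..<syms M})"

text \<open>A tape is a head position together with the contents of the cells.\<close>

type_synonym tape = "int \<times> (int \<Rightarrow> nat)"

type_synonym config = "nat \<times> tape list"

fun shift :: "move \<Rightarrow> int" where
  "shift Lft = -1"
| "shift Stay = 0"
| "shift Rgt = 1"

fun read_head :: "tape \<Rightarrow> nat" where
  "read_head (h, t) = t h"

fun act :: "nat \<times> move \<Rightarrow> tape \<Rightarrow> tape" where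
  "act (a, m) (h, t) = (h + shift m, t(h := a))"

fun step :: "tm \<Rightarrow> config \<Rightarrow> config" where
  "step M (s, ts) =
     (if s \<ge> ctrl M then (s, ts)
      else (let (s', as) = trans M s (map read_head ts) in (s', map2 act as ts)))"

definition blank_tape :: tape where
  "blank_tape = (0, \<lambda>_. 0)"

definition input_tape :: "nat list \<Rightarrow> tape" where
  "input_tape w = (0, \<lambda>i. if 0 \<le> i \<and> nat i < length w then w ! nat i else 0)"

definition init_config :: "tm \<Rightarrow> nat list \<Rightarrow> config" where
  "init_config M w = (0, input_tape w # replicate (tapes M - 1) blank_tape)"

text \<open>
  The word on a tape consists of the symbols from cell \<open>0\<close> up to the first blank. The input is
  given on the first tape and the output is read off the last tape.
\<close>

definition holds_word :: "tape \<Rightarrow> nat list \<Rightarrow> bool" where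
  "holds_word T v \<longleftrightarrow> 0 \<notin> set v \<and> (\<forall>i < length v. snd T (int i) = v ! i)
     \<and> snd T (int (length v)) = 0"

definition halts_with :: "tm \<Rightarrow> nat list \<Rightarrow> nat list \<Rightarrow> bool" where
  "halts_with M w v \<longleftrightarrow>
     (\<exists>k. let (s, ts) = (step M ^^ k) (init_config M w) in s = ctrl M \<and> holds_word (last ts) v)"

lemma halted_steps: "fst c = ctrl M \<Longrightarrow> (step M ^^ k) c = c"
  by (induction k) (cases c; simp)+

lemma holds_word_unique:
  assumes "holds_word T v" "holds_word T v'"
  shows "v = v'"
proof -
  have *: "\<not> length a < length b" if "holds_word T a" "holds_word T b" for a b
  proof
    assume l: "length a < length b"
    then have "b ! length a = 0"
      using that unfolding holds_word_def by metis
    then show False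
      using that(2) l unfolding holds_word_def by (metis nth_mem)
  qed
  have "length v = length v'"
    using *[OF assms] *[OF assms(2,1)] by linarith
  then show ?thesis
    using assms unfolding holds_word_def by (metis nth_equalityI)
qed

lemma halts_with_unique:
  assumes "halts_with M w v" "halts_with M w v'"
  shows "v = v'"
proof -
  let ?c = "\<lambda>k. (step M ^^ k) (init_config M w)"
  obtain k where k: "fst (?c k) = ctrl M" "holds_word (last (snd (?c k))) v"
    using assms(1) unfolding halts_with_def by (auto simp: case_prod_beta)
  obtain k' where k': "fst (?c k') = ctrl M" "holds_word (last (snd (?c k'))) v'"
    using assms(2) unfolding halts_with_def by (auto simp: case_prod_beta)
  have mono: "?c b = ?c a" if "fst (?c a) = ctrl M" "a \<le> b" for a b
    using halted_steps[OF that(1), of "b - a"] that(2)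
    by (metis comp_apply funpow_add le_add_diff_inverse2)
  have "?c k = ?c k'"
    using mono k(1) k'(1) by (metis nle_le)
  then show ?thesis
    using k k' holds_word_unique by metis
qed

text \<open>On a tape, the bits are the symbols \<open>1\<close> and \<open>2\<close>; the symbol \<open>3\<close> is a separator.\<close>

definition bits :: "bool list \<Rightarrow> nat list" where
  "bits = map (\<lambda>b. if b then 2 else 1)"

text \<open>Numbers are presented to machines in unary.\<close>

definition computable_nat :: "(nat \<Rightarrow> nat) \<Rightarrow> bool" where
  "computable_nat g \<longleftrightarrow>
     (\<exists>M. is_tm M \<and>
        (\<forall>n. halts_with M (bits (replicate n True)) (bits (replicate (g n) True))))"


section \<open>Length generalization\<close>

text \<open>
  An encoding system is represented by the map from a string to the function (the indicator of a
  language) that this string describes.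
\<close>

type_synonym encoding_system = "bool list \<Rightarrow> (bool list \<Rightarrow> bool)"

type_synonym sample = "(bool list \<times> bool) set"

definition training_data :: "nat \<Rightarrow> (bool list \<Rightarrow> bool) \<Rightarrow> sample" where
  "training_data N f = {(x, f x) | x. length x \<le> N}"

text \<open>
  A finite sample is written on the tape as the list of its elements; \<open>sorted_list_of_set\<close> refers
  here to the length-lexicographic order on strings. Each labelled string is followed by a
  separator, and so is its label.
\<close>

definition encode_sample :: "sample \<Rightarrow> nat list" where
  "encode_sample S = concat (map (\<lambda>(x, y). bits x @ [3] @ bits [y] @ [3]) (sorted_list_of_set S))"

definition learning_algorithm :: "tm \<Rightarrow> bool" where
  "learning_algorithm A \<longleftrightarrow> is_tm A \<and>
     (\<forall>N f. \<exists>p. halts_with A (encode_sample (training_data N f)) (bits p))"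

text \<open>The output is unique by \<open>halts_with_unique\<close> and the injectivity of \<open>bits\<close>.\<close>

definition learn :: "tm \<Rightarrow> sample \<Rightarrow> bool list" where
  "learn A S = (THE p. halts_with A (encode_sample S) (bits p))"

definition function_class :: "encoding_system \<Rightarrow> (bool list \<Rightarrow> bool) set" where
  "function_class R = range R"

definition complexity ::
  "encoding_system \<Rightarrow> (bool list \<Rightarrow> nat) \<Rightarrow> (bool list \<Rightarrow> bool) \<Rightarrow> nat" where
  "complexity R C f = (LEAST n. \<exists>p. R p = f \<and> C p = n)"

text \<open>The infimum of the empty set of extended naturals is \<open>\<infinity>\<close>.\<close>

definition gen_length :: "encoding_system \<Rightarrow> tm \<Rightarrow> (bool list \<Rightarrow> bool) \<Rightarrow> enat" where
  "gen_length R A f =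
     Inf {enat N | N. \<forall>n \<ge> N. R (learn A (training_data n f)) = f}"

definition gen_length_upto ::
  "encoding_system \<Rightarrow> (bool list \<Rightarrow> nat) \<Rightarrow> tm \<Rightarrow> nat \<Rightarrow> enat" where
  "gen_length_upto R C A c =
     Sup {gen_length R A f | f. f \<in> function_class R \<and> complexity R C f \<le> c}"

definition nonasymptotic_length_generalization ::
  "encoding_system \<Rightarrow> (bool list \<Rightarrow> nat) \<Rightarrow> bool" where
  "nonasymptotic_length_generalization R C \<longleftrightarrow>
     (\<exists>A Nhat. learning_algorithm A \<and> computable_nat Nhat \<and>
        (\<forall>f \<in> function_class R. \<forall>N' \<ge> Nhat (complexity R C f).
           R (learn A (training_data N' f)) = f))"


section \<open>The DFA encoding system\<close>

text \<open>
  The states are \<open>0, \<dots>, num_states M - 1\<close>. The values of \<open>delta M\<close> at other arguments are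
  irrelevant, so two records may represent the same automaton.
\<close>

record dfa =
  num_states :: nat
  start :: nat
  delta :: "nat \<Rightarrow> bool \<Rightarrow> nat"
  final :: "nat set"

definition is_dfa :: "dfa \<Rightarrow> bool" where
  "is_dfa M \<longleftrightarrow> start M < num_states M \<and> final M \<subseteq> {..<num_states M} \<and>
     (\<forall>q < num_states M. \<forall>b. delta M q b < num_states M)"

definition accepts :: "dfa \<Rightarrow> bool list \<Rightarrow> bool" where
  "accepts M x \<longleftrightarrow> foldl (delta M) (start M) x \<in> final M"

definition unary :: "nat \<Rightarrow> bool list" where
  "unary n = replicate n True @ [False]"

definition encode_state :: "dfa \<Rightarrow> nat \<Rightarrow> bool list" where
  "encode_state M q = unary (delta M q False) @ unary (delta M q True) @ [q \<in> final M]"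

definition encode_dfa :: "dfa \<Rightarrow> bool list" where
  "encode_dfa M = unary (num_states M) @ unary (start M) @
     concat (map (encode_state M) [0..<num_states M])"

definition R_DFA :: encoding_system where
  "R_DFA p = (\<lambda>x. \<exists>M. is_dfa M \<and> encode_dfa M = p \<and> accepts M x)"

text \<open>
  A string that encodes no DFA describes the empty language. Its complexity is set to \<open>1\<close>, the
  minimal number of states of a DFA for that language; thus \<open>complexity R_DFA C_DFA\<close> is the minimal
  number of states also for the empty language (see \<open>complexity_DFA\<close> below).
\<close>

definition C_DFA :: "bool list \<Rightarrow> nat" where
  "C_DFA p = (if \<exists>M. is_dfa M \<and> encode_dfa M = p
              then THE n. \<exists>M. is_dfa M \<and> encode_dfa M = p \<and> num_states M = n
              else 1)"

lemma unary_append_inject: "unary m @ xs = unary n @ ys \<longleftrightarrow> m = n \<and> xs = ys"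
  unfolding unary_def
proof (induction m arbitrary: n)
  case 0
  then show ?case by (cases n) auto
next
  case (Suc m)
  then show ?case by (cases n) auto
qed

lemma encode_dfa_inject:
  assumes "encode_dfa M = encode_dfa M'"
  shows "num_states M = num_states M'" and "start M = start M'"
    and "\<forall>q < num_states M. delta M q = delta M' q \<and> (q \<in> final M \<longleftrightarrow> q \<in> final M')"
proof -
  have *: "\<forall>q \<in> set qs. delta M q = delta M' q \<and> (q \<in> final M \<longleftrightarrow> q \<in> final M')"
    if "concat (map (encode_state M) qs) = concat (map (encode_state M') qs)" for qs
    using that
  proof (induction qs)
    case (Cons q qs)
    have eq: "delta M q False = delta M' q False \<and> delta M q True = delta M' q True \<and>
      (q \<in> final M) = (q \<in> final M') \<and>
      concat (map (encode_state M) qs) = concat (map (encode_state M') qs)"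
      using Cons.prems
      by (simp only: encode_state_def[of _ q] unary_append_inject append_assoc list.map concat.simps
          append_Cons append_Nil list.inject)
    have "delta M q b = delta M' q b" for b
      using eq by (cases b) (simp_all only:)
    then have "delta M q = delta M' q" by (rule ext)
    moreover have "\<forall>q \<in> set qs. delta M q = delta M' q \<and> (q \<in> final M \<longleftrightarrow> q \<in> final M')"
      using Cons.IH eq by blast
    ultimately show ?case
      using eq by (metis set_ConsD)
  qed simp
  have eq: "num_states M = num_states M' \<and> start M = start M' \<and>
    concat (map (encode_state M) [0..<num_states M]) =
    concat (map (encode_state M') [0..<num_states M'])"
    using assms unfolding encode_dfa_def unary_append_inject .
  then show "num_states M = num_states M'" "start M = start M'"
    by auto
  show "\<forall>q < num_states M. delta M q = delta M' q \<and> (q \<in> final M \<longleftrightarrow> q \<in> final M')"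
    using *[of "[0..<num_states M]"] eq by (metis atLeastLessThan_iff set_upt zero_le)
qed

lemma accepts_cong:
  assumes "is_dfa M" "encode_dfa M = encode_dfa M'"
  shows "accepts M x \<longleftrightarrow> accepts M' x"
proof -
  have closed: "delta M q b < num_states M" if "q < num_states M" for q b
    using assms(1) that by (simp add: is_dfa_def)
  have same: "delta M' q = delta M q" if "q < num_states M" for q
    using encode_dfa_inject(3)[OF assms(2)] that by simp
  have "q < num_states M \<Longrightarrow> foldl (delta M) q x < num_states M" for q
    by (induction x arbitrary: q) (simp_all add: closed)
  moreover have "q < num_states M \<Longrightarrow> foldl (delta M') q x = foldl (delta M) q x" for q
    by (induction x arbitrary: q) (simp_all add: closed same)
  ultimately show ?thesis
    using assms(1) encode_dfa_inject(2,3)[OF assms(2)] unfolding accepts_def is_dfa_def by metis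
qed

lemma R_DFA_encode: "is_dfa M \<Longrightarrow> R_DFA (encode_dfa M) = accepts M"
  unfolding R_DFA_def using accepts_cong by blast

lemma R_DFA_no_dfa: "\<nexists>M. is_dfa M \<and> encode_dfa M = p \<Longrightarrow> R_DFA p = (\<lambda>_. False)"
  unfolding R_DFA_def by blast

lemma C_DFA_encode:
  assumes "is_dfa M"
  shows "C_DFA (encode_dfa M) = num_states M"
proof -
  have "(THE n. \<exists>M'. is_dfa M' \<and> encode_dfa M' = encode_dfa M \<and> num_states M' = n) = num_states M"
    using assms encode_dfa_inject(1) by (intro the_equality) blast+
  then show ?thesis
    using assms unfolding C_DFA_def by (metis (lifting))
qed

lemma ex_dfa_empty: "\<exists>M. is_dfa M \<and> num_states M = 1 \<and> accepts M = (\<lambda>_. False)"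
  by (rule exI[of _ "\<lparr>num_states = 1, start = 0, delta = \<lambda>_ _. 0, final = {}\<rparr>"])
    (simp add: is_dfa_def accepts_def fun_eq_iff)

lemma R_DFA_accepts: "\<exists>M. is_dfa M \<and> R_DFA p = accepts M"
proof (cases "\<exists>M. is_dfa M \<and> encode_dfa M = p")
  case True
  then show ?thesis using R_DFA_encode by blast
next
  case False
  then show ?thesis using R_DFA_no_dfa[OF False] ex_dfa_empty by auto
qed

lemma function_class_DFA: "function_class R_DFA = {accepts M | M. is_dfa M}"
proof (intro equalityI subsetI)
  fix f assume "f \<in> function_class R_DFA"
  then show "f \<in> {accepts M | M. is_dfa M}"
    using R_DFA_accepts unfolding function_class_def by blast
next
  fix f assume "f \<in> {accepts M | M. is_dfa M}"
  then obtain M where M: "is_dfa M" "f = accepts M" by blast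
  then have "f = R_DFA (encode_dfa M)" by (simp only: R_DFA_encode)
  then show "f \<in> function_class R_DFA" by (simp add: function_class_def)
qed

lemma complexity_DFA:
  "complexity R_DFA C_DFA f = (LEAST n. \<exists>M. is_dfa M \<and> accepts M = f \<and> num_states M = n)"
proof -
  have 1: "\<exists>M. is_dfa M \<and> accepts M = R_DFA p \<and> num_states M = C_DFA p" for p
  proof (cases "\<exists>M. is_dfa M \<and> encode_dfa M = p")
    case True
    then obtain M where M: "is_dfa M" "p = encode_dfa M" by blast
    show ?thesis
      unfolding M(2) R_DFA_encode[OF M(1)] C_DFA_encode[OF M(1)] using M(1) by blast
  next
    case False
    then have "C_DFA p = 1" unfolding C_DFA_def by (rule if_not_P)
    then show ?thesis
      unfolding R_DFA_no_dfa[OF False] using ex_dfa_empty by (simp only:) blast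
  qed
  have 2: "\<exists>p. R_DFA p = accepts M \<and> C_DFA p = num_states M" if "is_dfa M" for M
    using R_DFA_encode[OF that] C_DFA_encode[OF that] by blast
  have "(\<exists>p. R_DFA p = f \<and> C_DFA p = n) \<longleftrightarrow>
      (\<exists>M. is_dfa M \<and> accepts M = f \<and> num_states M = n)" for n
    using 1 2 by (intro iffI; elim exE conjE; hypsubst) simp_all
  then show ?thesis by (simp add: complexity_def)
qed

end

(*
  The states of the learned automaton are the words of length at most N, and the a-successor of a
  word u is the first word w, in length-lexicographic order, that the data do not distinguish from
  ua: w and ua have equal labels after appending any v with |ua| + |v| <= N. Let f be accepted by an
  automaton with c states and N >= 2c - 2. By induction the reachable states are words of length at
  most c - 1: then |ua| <= c, so all v of length at most c - 2 are tested, and by partition refinement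
  these tests decide equivalence; hence w is the first word equivalent to ua, and some word of length
  at most c - 1 is equivalent to ua.

  In length-lexicographic order the words are the nodes of a binary heap, so the machine only needs
  counters for heap positions. A counter is the position of a head on a tape that carries the table
  of labels, so that reading a tape looks the label up.
*)

theory Submission
  imports Defs
begin

section \<open>While programs for Turing machines\<close>

type_synonym action = "nat list \<Rightarrow> nat \<Rightarrow> nat \<times> move"

type_synonym store = "nat \<Rightarrow> tape"

datatype prog =
    Act action
  | Seq prog prog (infixr ";;" 60)
  | While "nat list \<Rightarrow> bool" prog

definition reads :: "nat \<Rightarrow> store \<Rightarrow> nat list" where
  "reads k \<tau> = map (\<lambda>j. read_head (\<tau> j)) [0..<k]"

definition perform :: "nat \<Rightarrow> action \<Rightarrow> store \<Rightarrow> store" where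
  "perform k f \<tau> = (\<lambda>j. if j < k then act (f (reads k \<tau>) j) (\<tau> j) else \<tau> j)"

inductive exec :: "nat \<Rightarrow> prog \<Rightarrow> store \<Rightarrow> store \<Rightarrow> bool" for k where
  Act: "exec k (Act f) \<tau> (perform k f \<tau>)"
| Seq: "exec k c \<tau> \<tau>' \<Longrightarrow> exec k d \<tau>' \<tau>'' \<Longrightarrow> exec k (c ;; d) \<tau> \<tau>''"
| While_False: "\<not> P (reads k \<tau>) \<Longrightarrow> exec k (While P c) \<tau> \<tau>"
| While_True: "P (reads k \<tau>) \<Longrightarrow> exec k c \<tau> \<tau>' \<Longrightarrow> exec k (While P c) \<tau>' \<tau>'' \<Longrightarrow>
    exec k (While P c) \<tau> \<tau>''"

text \<open>A loop is verified by writing down its whole trace, \<open>S i\<close> being the store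
  after \<open>i\<close> rounds. This replaces an invariant and a termination measure.\<close>

lemma exec_While_seq:
  assumes "\<And>i. i < n \<Longrightarrow> P (reads k (S i))"
    and "\<And>i. i < n \<Longrightarrow> exec k c (S i) (S (Suc i))"
    and "\<not> P (reads k (S n))"
    and "\<tau> = S 0" and "\<tau>' = S n"
  shows "exec k (While P c) \<tau> \<tau>'"
proof -
  have "exec k (While P c) (S 0) (S n)"
  \<comment> \<open>The induction runs downwards from \<open>n\<close>, because
    \<open>While_True\<close> adds a round at the front.\<close>
  proof (rule inc_induct[of 0 n])
    show "exec k (While P c) (S n) (S n)"
      using assms(3) by (rule exec.While_False)
  next
    fix i assume "i < n" "exec k (While P c) (S (Suc i)) (S n)"
    then show "exec k (While P c) (S i) (S n)"
      using assms(1,2) exec.While_True by blast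
  qed simp
  then show ?thesis using assms(4,5) by simp
qed

section \<open>Compilation to Turing machines\<close>

fun plen :: "prog \<Rightarrow> nat" where
  "plen (Act f) = 1"
| "plen (c ;; d) = plen c + plen d"
| "plen (While P c) = plen c + 2"

text \<open>The test of a loop and the jump back to it each cost a machine step, which must leave
  all tapes alone.\<close>

definition idle :: action where
  "idle = (\<lambda>rs j. (rs ! j, Stay))"

text \<open>The second argument is the state at which the code is entered; it is left at this state
  plus the length of the code.\<close>

fun compile :: "prog \<Rightarrow> nat \<Rightarrow> ((nat list \<Rightarrow> nat) \<times> action) list" where
  "compile (Act f) b = [(\<lambda>_. Suc b, f)]"
| "compile (c ;; d) b = compile c b @ compile d (b + plen c)"
| "compile (While P c) b =
     (\<lambda>rs. if P rs then Suc b else b + plen c + 2, idle) # compile c (Suc b) @ [(\<lambda>_. b, idle)]"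

text \<open>The exit of the code, \<open>plen c\<close>, is the halting state. The four symbols are
  the blank \<open>0\<close>, the bits \<open>1\<close> and \<open>2\<close>, and \<open>3\<close>
  as separator or mark.\<close>

definition machine :: "nat \<Rightarrow> prog \<Rightarrow> tm" where
  "machine k c = \<lparr>tapes = k, ctrl = plen c, syms = 4,
     trans = (\<lambda>s rs. (fst (compile c 0 ! s) rs, map (snd (compile c 0 ! s) rs) [0..<k]))\<rparr>"

lemma length_compile [simp]: "length (compile c b) = plen c"
  by (induction c arbitrary: b) auto

fun safe :: "nat \<Rightarrow> prog \<Rightarrow> bool" where
  "safe k (Act f) \<longleftrightarrow>
     (\<forall>rs. length rs = k \<and> set rs \<subseteq> {..<4} \<longrightarrow> (\<forall>j < k. fst (f rs j) < 4))"
| "safe k (c ;; d) \<longleftrightarrow> safe k c \<and> safe k d"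
| "safe k (While P c) \<longleftrightarrow> safe k c"

lemma compile_safe:
  assumes "safe k c" "(nxt, f) \<in> set (compile c b)" "length rs = k" "set rs \<subseteq> {..<4}"
  shows "nxt rs \<le> b + plen c \<and> (\<forall>j < k. fst (f rs j) < 4)"
  using assms
proof (induction c arbitrary: b)
  case (Seq c d)
  then show ?case by fastforce
next
  case (While P c)
  have "\<forall>j < k. fst (idle rs j) < 4"
    using While.prems(3,4) nth_mem by (fastforce simp: idle_def)
  then show ?case
    using While.IH[of "Suc b"] While.prems by fastforce
qed auto

lemma is_tm_machine:
  assumes "safe k c" "k \<ge> 1"
  shows "is_tm (machine k c)"
proof -
  have "fst (compile c 0 ! s) rs \<le> plen c \<and> (\<forall>j < k. fst (snd (compile c 0 ! s) rs j) < 4)"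
    if "s < plen c" "length rs = k" "set rs \<subseteq> {..<4}" for s rs
    using compile_safe[OF assms(1) _ that(2,3), where b = 0] that(1)
    by (metis add_0 length_compile nth_mem prod.collapse)
  then show ?thesis
    using assms(2) by (auto simp: is_tm_def machine_def)
qed

lemma step_machine:
  assumes "compile c 0 ! s = (nxt, f)" "s < plen c"
  shows "step (machine k c) (s, map \<tau> [0..<k]) =
    (nxt (reads k \<tau>), map (perform k f \<tau>) [0..<k])"
  using assms
  by (auto simp: machine_def reads_def perform_def comp_def map2_map_map intro!: nth_equalityI)

lemma perform_idle [simp]: "perform k idle \<tau> = \<tau>"
proof
  fix j
  show "perform k idle \<tau> j = \<tau> j"
    by (cases "\<tau> j") (simp add: perform_def idle_def reads_def)
qed

text \<open>The induction is on the derivation of \<open>exec\<close>, so loops are known to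
  terminate. The code of \<open>c\<close> may sit anywhere inside that of \<open>d\<close>; this
  lets the induction pass to the parts of a sequence and to the body of a loop.\<close>

lemma exec_machine:
  assumes "exec k c \<tau> \<tau>'" "compile d 0 = xs @ compile c (length xs) @ ys"
  shows "\<exists>t. (step (machine k d) ^^ t) (length xs, map \<tau> [0..<k]) =
    (length xs + plen c, map \<tau>' [0..<k])"
  using assms
proof (induction arbitrary: xs ys)
  case (Act f \<tau>)
  then have "compile d 0 ! length xs = (\<lambda>_. Suc (length xs), f)" by simp
  moreover have "length xs < plen d"
    using arg_cong[OF Act.prems, of length] by simp
  ultimately show ?case
    by (intro exI[of _ 1]) (simp add: step_machine del: step.simps)
next
  case (Seq c \<tau> \<tau>' e \<tau>'')
  from Seq.prems have "compile d 0 = xs @ compile c (length xs) @ (compile e (length xs + plen c) @ ys)"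
    by simp
  from Seq.IH(1)[OF this] obtain t where t: "(step (machine k d) ^^ t) (length xs, map \<tau> [0..<k]) =
    (length xs + plen c, map \<tau>' [0..<k])" by blast
  from Seq.prems have "compile d 0 = (xs @ compile c (length xs)) @
      compile e (length (xs @ compile c (length xs))) @ ys"
    by simp
  from Seq.IH(2)[OF this] obtain t' where "(step (machine k d) ^^ t')
      (length xs + plen c, map \<tau>' [0..<k]) = (length xs + plen c + plen e, map \<tau>'' [0..<k])"
    by auto
  with t have "(step (machine k d) ^^ (t' + t)) (length xs, map \<tau> [0..<k]) =
      (length xs + plen c + plen e, map \<tau>'' [0..<k])"
    by (simp add: funpow_add)
  then show ?case by (auto simp: add.assoc)
next
  case (While_False P \<tau> c)
  have "compile d 0 ! length xs =
      (\<lambda>rs. if P rs then Suc (length xs) else length xs + plen c + 2, idle)"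
    using While_False.prems by simp
  moreover have "length xs < plen d"
    using arg_cong[OF While_False.prems, of length] by simp
  ultimately show ?case
    using While_False.hyps by (intro exI[of _ 1]) (simp add: step_machine del: step.simps)
next
  case (While_True P \<tau> c \<tau>' \<tau>'')
  let ?step = "step (machine k d)"
  let ?b = "length xs"
  let ?br = "(\<lambda>rs. if P rs then Suc ?b else ?b + plen c + 2, idle)"
  have len: "?b + plen c + 1 < plen d"
    using arg_cong[OF While_True.prems, of length] by simp
  have "compile d 0 ! ?b = ?br"
    using While_True.prems by simp
  then have 1: "?step (?b, map \<tau> [0..<k]) = (Suc ?b, map \<tau> [0..<k])"
    using While_True.hyps(1) len by (simp add: step_machine del: step.simps)
  have code: "compile d 0 = (xs @ [?br]) @ compile c (length (xs @ [?br])) @ ((\<lambda>_. ?b, idle) # ys)"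
    using While_True.prems by simp
  from While_True.IH(1)[OF this] obtain t where t: "(?step ^^ t) (Suc ?b, map \<tau> [0..<k]) =
      (Suc ?b + plen c, map \<tau>' [0..<k])" by auto
  have "compile d 0 ! (Suc ?b + plen c) = (\<lambda>_. ?b, idle)"
    unfolding code by (simp add: nth_append)
  then have 2: "?step (Suc ?b + plen c, map \<tau>' [0..<k]) = (?b, map \<tau>' [0..<k])"
    using len by (simp add: step_machine del: step.simps)
  from While_True.IH(2)[OF While_True.prems] obtain t' where
    t': "(?step ^^ t') (?b, map \<tau>' [0..<k]) = (?b + plen (While P c), map \<tau>'' [0..<k])"
    by blast
  \<comment> \<open>One step for the test, \<open>t\<close> for the body, one for the jump back,
    then \<open>t'\<close> for the remaining rounds.\<close>
  have "(?step ^^ (t' + (1 + (t + 1)))) (?b, map \<tau> [0..<k]) =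
      (?b + plen (While P c), map \<tau>'' [0..<k])"
    unfolding funpow_add comp_apply funpow.simps(2) One_nat_def funpow_0 1 t 2 t' by (rule refl)
  then show ?case by blast
qed

definition init_store :: "nat list \<Rightarrow> store" where
  "init_store w = (\<lambda>j. if j = 0 then input_tape w else blank_tape)"

lemma halts_with_machine:
  assumes "exec k c (init_store w) \<tau>" "holds_word (\<tau> (k - 1)) v" "k \<ge> 1"
  shows "halts_with (machine k c) w v"
proof -
  have "init_config (machine k c) w = (0, map (init_store w) [0..<k])"
    using assms(3)
    by (auto simp: init_config_def machine_def init_store_def nth_Cons' intro!: nth_equalityI)
  moreover obtain t where "(step (machine k c) ^^ t) (0, map (init_store w) [0..<k]) =
      (plen c, map \<tau> [0..<k])"
    using exec_machine[OF assms(1), of c "[]" "[]"] by auto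
  moreover have "last (map \<tau> [0..<k]) = \<tau> (k - 1)"
    using assms(3) by (simp add: last_map)
  ultimately show ?thesis
    using assms(2) unfolding halts_with_def
    by (intro exI[of _ t]) (simp add: machine_def)
qed

section \<open>The learner as a while program\<close>

definition cells :: "nat list \<Rightarrow> int \<Rightarrow> nat" where
  "cells w i = (if 0 \<le> i \<and> nat i < length w then w ! nat i else 0)"

text \<open>Heap positions start at \<open>1\<close>, so cell \<open>0\<close> is free for the mark
  \<open>3\<close>: reading \<open>3\<close> means that a register is zero, reading \<open>0\<close>
  that its position lies beyond the data.\<close>

definition sym :: "nat list \<Rightarrow> nat \<Rightarrow> nat" where
  "sym T i = (if i = 0 then 3 else if i \<le> length T then T ! (i - 1) else 0)"

definition table :: "nat list \<Rightarrow> int \<Rightarrow> nat" where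
  "table T i = (if i < 0 then 0 else sym T (nat i))"

text \<open>Tape \<open>0\<close> is the input, tape \<open>9\<close> the output. Each of the tapes \<open>1, \<dots>, 8\<close> carries a copy of the
  table \<open>T\<close> of labels, and the position of its head is the content of a register.\<close>

definition conf :: "nat list \<Rightarrow> nat \<Rightarrow> nat list \<Rightarrow> (nat \<Rightarrow> nat) \<Rightarrow> nat list \<Rightarrow> store" where
  "conf w h T R o' = (\<lambda>j. if j = 0 then (int h, cells w)
     else if j < 9 then (int (R j), table T)
     else if j = 9 then (int (length o'), cells o')
     else blank_tape)"

section \<open>Tape actions as register operations\<close>

lemma reads_conf [simp]:
  "reads 10 (conf w h T R o') ! 0 = (if h < length w then w ! h else 0)"
  "0 < j \<Longrightarrow> j < 9 \<Longrightarrow> reads 10 (conf w h T R o') ! j = sym T (R j)"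
  by (auto simp: reads_def conf_def cells_def table_def)

lemma exec_ActI: "perform k f \<tau> = \<tau>' \<Longrightarrow> exec k (Act f) \<tau> \<tau>'"
  using exec.Act by metis

lemma perform_eq:
  "perform k f \<tau> j = (if j < k then (fst (\<tau> j) + shift (snd (f (reads k \<tau>) j)),
     (snd (\<tau> j))(fst (\<tau> j) := fst (f (reads k \<tau>) j))) else \<tau> j)"
  by (cases "\<tau> j"; cases "f (reads k \<tau>) j") (simp add: perform_def)

lemma perform_move:
  "perform k (\<lambda>rs j. (rs ! j, mv rs j)) \<tau> =
    (\<lambda>j. if j < k then (fst (\<tau> j) + shift (mv (reads k \<tau>) j), snd (\<tau> j)) else \<tau> j)"
proof
  fix j
  show "perform k (\<lambda>rs j. (rs ! j, mv rs j)) \<tau> j =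
    (if j < k then (fst (\<tau> j) + shift (mv (reads k \<tau>) j), snd (\<tau> j)) else \<tau> j)"
    by (cases "\<tau> j") (simp add: perform_def reads_def)
qed

lemma conf_cong: "(\<And>j. 0 < j \<Longrightarrow> j < 9 \<Longrightarrow> R j = R' j) \<Longrightarrow> conf w h T R o' = conf w h T R' o'"
  by (auto simp: conf_def fun_eq_iff)

definition adjust :: "(nat list \<Rightarrow> nat set) \<Rightarrow> nat set \<Rightarrow> prog" where
  "adjust I D = Act (\<lambda>rs j. (rs ! j, if j \<in> I rs then Rgt else if j \<in> D then Lft else Stay))"

text \<open>Raising wins over lowering for a register in both \<open>J\<close> and \<open>D\<close>.
  Lowered registers must be positive, so that subtraction on naturals matches the move of the
  head.\<close>

lemma exec_adjust:
  assumes "I (reads 10 (conf w h T R o')) = J" "J \<subseteq> {1..8}" "D \<subseteq> {1..8}"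
    and "\<And>j. j \<in> D \<Longrightarrow> R j > 0"
    and "\<And>j. 0 < j \<Longrightarrow> j < 9 \<Longrightarrow> R' j = (if j \<in> J then R j + 1 else if j \<in> D then R j - 1 else R j)"
  shows "exec 10 (adjust I D) (conf w h T R o') (conf w h T R' o')"
proof -
  let ?f = "\<lambda>rs j. (rs ! j, if j \<in> I rs then Rgt else if j \<in> D then Lft else Stay)"
  have "perform 10 ?f (conf w h T R o') = conf w h T R' o'"
  proof
    fix j :: nat
    have "0 \<notin> J" "0 \<notin> D" "j \<ge> 9 \<Longrightarrow> j \<notin> J \<and> j \<notin> D" using assms(2,3) by auto
    moreover have "j \<in> D \<Longrightarrow> int (R j - 1) = int (R j) - 1"
      using assms(4)[of j] by simp
    ultimately show "perform 10 ?f (conf w h T R o') j = conf w h T R' o' j"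
      unfolding perform_move assms(1) using assms(5)[of j] by (auto simp: conf_def)
  qed
  then show ?thesis unfolding adjust_def by (rule exec_ActI)
qed

lemma nth_less_syms: "length rs = k \<Longrightarrow> set rs \<subseteq> {..<4} \<Longrightarrow> j < k \<Longrightarrow> rs ! j < (4::nat)"
  using nth_mem by fastforce

lemma safe_adjust [simp]: "safe k (adjust I D)"
  by (simp add: adjust_def nth_less_syms)

definition emit :: "(nat list \<Rightarrow> nat) \<Rightarrow> prog" where
  "emit g = Act (\<lambda>rs j. if j = 9 then (g rs, Rgt) else (rs ! j, Stay))"

lemma cells_append: "(cells w)(int (length w) := a) = cells (w @ [a])"
  by (auto simp: cells_def fun_eq_iff nth_append)

lemma exec_emit:
  assumes "g (reads 10 (conf w h T R o')) = a"
  shows "exec 10 (emit g) (conf w h T R o') (conf w h T R (o' @ [a]))"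
proof -
  let ?f = "\<lambda>rs j. if j = 9 then (g rs, Rgt) else (rs ! j, Stay)"
  have "perform 10 ?f (conf w h T R o') = conf w h T R (o' @ [a])"
  proof
    fix j :: nat
    show "perform 10 ?f (conf w h T R o') j = conf w h T R (o' @ [a]) j"
    proof (cases "j = 9")
      case True
      have "snd (conf w h T R o' 9) = cells o'" "fst (conf w h T R o' 9) = int (length o')"
        "conf w h T R (o' @ [a]) 9 = (int (length o') + 1, cells (o' @ [a]))"
        by (simp_all add: conf_def)
      then show ?thesis
        unfolding True by (simp add: perform_eq assms cells_append)
    next
      case False
      have "conf w h T R (o' @ [a]) j = conf w h T R o' j"
        using False by (simp add: conf_def)
      then show ?thesis
        using False by (cases "conf w h T R o' j") (simp add: perform_def reads_def)
    qed
  qed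
  then show ?thesis unfolding emit_def by (rule exec_ActI)
qed

lemma safe_emit [simp]: "(\<And>rs. length rs = k \<Longrightarrow> set rs \<subseteq> {..<4} \<Longrightarrow> g rs < 4) \<Longrightarrow> safe k (emit g)"
  by (simp add: emit_def nth_less_syms)

section \<open>The subroutines and the main program\<close>

definition clear :: "nat \<Rightarrow> prog" where
  "clear r = While (\<lambda>rs. rs ! r \<noteq> 3) (adjust (\<lambda>_. {}) {r})"

text \<open>Counting a register down destroys it, so \<open>7\<close> receives a second copy from
  which \<open>r\<close> is restored.\<close>

definition copy :: "nat \<Rightarrow> nat \<Rightarrow> prog" where
  "copy r s = While (\<lambda>rs. rs ! r \<noteq> 3) (adjust (\<lambda>_. {s, 7}) {r}) ;;
     While (\<lambda>rs. rs ! 7 \<noteq> 3) (adjust (\<lambda>_. {r}) {7})"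

definition double :: "nat \<Rightarrow> prog" where
  "double r = While (\<lambda>rs. rs ! r \<noteq> 3) (adjust (\<lambda>_. {7}) {r} ;; adjust (\<lambda>_. {7}) {}) ;;
     While (\<lambda>rs. rs ! 7 \<noteq> 3) (adjust (\<lambda>_. {r}) {7})"

text \<open>The heads of \<open>4\<close> and \<open>5\<close> run in parallel over one level and
  the labels they read are compared on the way; \<open>7\<close> counts the steps, so that
  \<open>4\<close>, \<open>5\<close> and \<open>6\<close> can be restored.\<close>

definition compare_block :: prog where
  "compare_block =
     While (\<lambda>rs. rs ! 6 \<noteq> 3)
       (adjust (\<lambda>rs. {4, 5, 7} \<union> (if rs ! 4 = rs ! 5 then {} else {8})) {6}) ;;
     While (\<lambda>rs. rs ! 7 \<noteq> 3) (adjust (\<lambda>_. {6}) {4, 5, 7})"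

text \<open>Register \<open>1\<close> is the heap position of the current word, \<open>2\<close> that of its successor \<open>m\<close>, and \<open>3\<close>
  the candidate \<open>w\<close>. Registers \<open>4\<close>, \<open>5\<close>, \<open>6\<close> are the left ends and the width of the current level in
  the subtrees with roots \<open>w\<close> and \<open>m\<close>; \<open>8\<close> counts the disagreements and \<open>7\<close> is scratch.\<close>

definition match :: prog where
  "match = copy 3 4 ;; copy 2 5 ;; adjust (\<lambda>_. {6}) {} ;;
     While (\<lambda>rs. rs ! 5 \<noteq> 0) (compare_block ;; double 4 ;; double 5 ;; double 6) ;;
     clear 4 ;; clear 5 ;; clear 6"

text \<open>Every rejected candidate puts a \<open>True\<close> on the output, so the unary code of
  the successor is written while it is being found. Acceptance means that \<open>8\<close> reads the
  mark, that is, has counted no disagreement.\<close>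

definition search :: prog where
  "search = adjust (\<lambda>_. {3}) {} ;; match ;;
     While (\<lambda>rs. rs ! 8 \<noteq> 3) (emit (\<lambda>_. 2) ;; clear 8 ;; adjust (\<lambda>_. {3}) {} ;; match) ;;
     emit (\<lambda>_. 1) ;; clear 3"

text \<open>For the position \<open>n\<close> in \<open>1\<close>, the heap children
  \<open>2 * n\<close> and \<open>2 * n + 1\<close> are searched in turn; two increments leave
  \<open>2\<close> at the first child of the next word. The label read on tape \<open>1\<close> is
  also the bit for membership in \<open>final\<close>.\<close>

definition states :: prog where
  "states = adjust (\<lambda>_. {1, 2}) {} ;; adjust (\<lambda>_. {2}) {} ;;
     While (\<lambda>rs. rs ! 1 \<noteq> 0)
       (search ;; adjust (\<lambda>_. {2}) {} ;; search ;; adjust (\<lambda>_. {2}) {} ;; emit (\<lambda>rs. rs ! 1) ;;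
        adjust (\<lambda>_. {1}) {})"

definition advance :: prog where
  "advance = Act (\<lambda>rs j. (rs ! j, if j = 0 then Rgt else Stay))"

definition mark :: prog where
  "mark = Act (\<lambda>rs j. if 0 < j \<and> j < 9 then (3, Rgt) else (rs ! j, Stay))"

text \<open>Each sample also adds a \<open>True\<close> to the output, where the number of states is
  to stand in unary.\<close>

definition record_label :: prog where
  "record_label = Act (\<lambda>rs j. (if j = 0 then rs ! 0 else if j = 9 then 2 else rs ! 0, Rgt))"

text \<open>The first emitted \<open>1\<close> ends the unary number of states; the second is
  \<open>unary 0\<close> for the start state, the empty word.\<close>

definition read_sample :: prog where
  "read_sample = mark ;;
     While (\<lambda>rs. rs ! 0 \<noteq> 0)
       (While (\<lambda>rs. rs ! 0 \<noteq> 3) advance ;; advance ;; record_label ;; advance) ;;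
     emit (\<lambda>_. 1) ;; emit (\<lambda>_. 1) ;;
     While (\<lambda>rs. rs ! 1 \<noteq> 3) (adjust (\<lambda>_. {}) {1..8})"

definition learner :: prog where
  "learner = read_sample ;; states"

lemma safe_learner: "safe 10 learner"
  by (simp add: learner_def read_sample_def states_def search_def match_def compare_block_def
      double_def copy_def clear_def advance_def mark_def record_label_def nth_less_syms)

section \<open>Effect of the arithmetic subroutines\<close>

definition labels :: "nat list \<Rightarrow> bool" where
  "labels T \<longleftrightarrow> set T \<subseteq> {1, 2}"

lemma sym_labels:
  assumes "labels T"
  shows "sym T i = 3 \<longleftrightarrow> i = 0" "sym T i = 0 \<longleftrightarrow> length T < i"
proof -
  have "T ! (i - 1) \<in> {1, 2}" if "i \<noteq> 0" "i \<le> length T"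
    proof -
    have "T ! (i - 1) \<in> set T" using that by (intro nth_mem) linarith
    then show ?thesis using assms unfolding labels_def by blast
  qed
  then show "sym T i = 3 \<longleftrightarrow> i = 0" "sym T i = 0 \<longleftrightarrow> length T < i"
    by (force simp: sym_def)+
qed

definition mism :: "nat list \<Rightarrow> nat \<Rightarrow> nat \<Rightarrow> nat \<Rightarrow> nat" where
  "mism T P Q L = (\<Sum>i<L. if sym T (P + i) = sym T (Q + i) then 0 else 1)"

context
  fixes T :: "nat list"
  assumes T: "labels T"
begin

lemma exec_clear:
  assumes "0 < r" "r < 9"
  shows "exec 10 (clear r) (conf w h T R o') (conf w h T (R(r := 0)) o')"
  unfolding clear_def
  by (rule exec_While_seq[where n = "R r" and S = "\<lambda>i. conf w h T (R(r := R r - i)) o'"])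
    (use assms in \<open>auto simp: sym_labels[OF T] intro!: exec_adjust[OF refl] conf_cong\<close>)

lemma exec_copy:
  assumes "0 < r" "r < 9" "0 < s" "s < 9" "r \<noteq> s" "r \<noteq> 7" "s \<noteq> 7" "R s = 0" "R 7 = 0"
  shows "exec 10 (copy r s) (conf w h T R o') (conf w h T (R(s := R r)) o')"
  unfolding copy_def
proof (rule exec.Seq)
  show "exec 10 (While (\<lambda>rs. rs ! r \<noteq> 3) (adjust (\<lambda>_. {s, 7}) {r})) (conf w h T R o')
      (conf w h T (R(r := 0, s := R r, 7 := R r)) o')"
    by (rule exec_While_seq[where n = "R r" and
          S = "\<lambda>i. conf w h T (R(r := R r - i, s := i, 7 := i)) o'"])
      (use assms in \<open>auto simp: sym_labels[OF T] intro!: exec_adjust[OF refl] conf_cong\<close>)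
  show "exec 10 (While (\<lambda>rs. rs ! 7 \<noteq> 3) (adjust (\<lambda>_. {r}) {7}))
      (conf w h T (R(r := 0, s := R r, 7 := R r)) o') (conf w h T (R(s := R r)) o')"
    by (rule exec_While_seq[where n = "R r" and
          S = "\<lambda>i. conf w h T (R(r := i, s := R r, 7 := R r - i)) o'"])
      (use assms in \<open>auto simp: sym_labels[OF T] intro!: exec_adjust[OF refl] conf_cong\<close>)
qed

lemma exec_double:
  assumes "0 < r" "r < 9" "r \<noteq> 7" "R 7 = 0"
  shows "exec 10 (double r) (conf w h T R o') (conf w h T (R(r := 2 * R r)) o')"
  unfolding double_def
proof (rule exec.Seq)
  show "exec 10 (While (\<lambda>rs. rs ! r \<noteq> 3) (adjust (\<lambda>_. {7}) {r} ;; adjust (\<lambda>_. {7}) {}))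
      (conf w h T R o') (conf w h T (R(r := 0, 7 := 2 * R r)) o')"
  proof (rule exec_While_seq[where n = "R r" and
        S = "\<lambda>i. conf w h T (R(r := R r - i, 7 := 2 * i)) o'"])
    fix i assume i: "i < R r"
    show "exec 10 (adjust (\<lambda>_. {7}) {r} ;; adjust (\<lambda>_. {7}) {})
        (conf w h T (R(r := R r - i, 7 := 2 * i)) o')
        (conf w h T (R(r := R r - Suc i, 7 := 2 * Suc i)) o')"
      by (rule exec.Seq[of _ _ _ "conf w h T (R(r := R r - Suc i, 7 := Suc (2 * i))) o'"];
          rule exec_adjust[OF refl]) (use assms i in auto)
  qed (use assms in \<open>auto simp: sym_labels[OF T] intro!: conf_cong\<close>)
  show "exec 10 (While (\<lambda>rs. rs ! 7 \<noteq> 3) (adjust (\<lambda>_. {r}) {7}))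
      (conf w h T (R(r := 0, 7 := 2 * R r)) o') (conf w h T (R(r := 2 * R r)) o')"
    by (rule exec_While_seq[where n = "2 * R r" and
          S = "\<lambda>i. conf w h T (R(r := i, 7 := 2 * R r - i)) o'"])
      (use assms in \<open>auto simp: sym_labels[OF T] intro!: exec_adjust[OF refl] conf_cong\<close>)
qed

lemma exec_compare_block:
  assumes "R 7 = 0"
  shows "exec 10 compare_block (conf w h T R o')
    (conf w h T (R(8 := R 8 + mism T (R 4) (R 5) (R 6))) o')"
  unfolding compare_block_def
proof (rule exec.Seq)
  let ?m = "mism T (R 4) (R 5)"
  show "exec 10 (While (\<lambda>rs. rs ! 6 \<noteq> 3)
      (adjust (\<lambda>rs. {4, 5, 7} \<union> (if rs ! 4 = rs ! 5 then {} else {8})) {6})) (conf w h T R o')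
      (conf w h T (R(4 := R 4 + R 6, 5 := R 5 + R 6, 6 := 0, 7 := R 6, 8 := R 8 + ?m (R 6))) o')"
    by (rule exec_While_seq[where n = "R 6" and
          S = "\<lambda>i. conf w h T (R(4 := R 4 + i, 5 := R 5 + i, 6 := R 6 - i, 7 := i,
            8 := R 8 + ?m i)) o'"])
      (use assms in \<open>auto simp: sym_labels[OF T] mism_def intro!: exec_adjust[OF refl] conf_cong\<close>)
  show "exec 10 (While (\<lambda>rs. rs ! 7 \<noteq> 3) (adjust (\<lambda>_. {6}) {4, 5, 7}))
      (conf w h T (R(4 := R 4 + R 6, 5 := R 5 + R 6, 6 := 0, 7 := R 6, 8 := R 8 + ?m (R 6))) o')
      (conf w h T (R(8 := R 8 + ?m (R 6))) o')"
    by (rule exec_While_seq[where n = "R 6" and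
          S = "\<lambda>i. conf w h T (R(4 := R 4 + R 6 - i, 5 := R 5 + R 6 - i, 6 := i, 7 := R 6 - i,
            8 := R 8 + ?m (R 6))) o'"])
      (use assms in \<open>auto simp: sym_labels[OF T] intro!: exec_adjust[OF refl] conf_cong\<close>)
qed

end

text \<open>The descendants of \<open>m\<close> at distance \<open>l\<close> occupy the positions
  \<open>m * 2 ^ l + i\<close> with \<open>i < 2 ^ l\<close>. If the table covers all words up to
  some length, a level that starts inside it also ends inside it.\<close>

definition agree :: "nat list \<Rightarrow> nat \<Rightarrow> nat \<Rightarrow> bool" where
  "agree T w m \<longleftrightarrow> (\<forall>l i. m * 2 ^ l \<le> length T \<longrightarrow> i < 2 ^ l \<longrightarrow>
     sym T (w * 2 ^ l + i) = sym T (m * 2 ^ l + i))"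

definition rep :: "nat list \<Rightarrow> nat \<Rightarrow> nat" where
  "rep T m = (LEAST w. 0 < w \<and> agree T w m)"

definition depth :: "nat list \<Rightarrow> nat \<Rightarrow> nat" where
  "depth T m = (LEAST l. length T < m * 2 ^ l)"

definition err :: "nat list \<Rightarrow> nat \<Rightarrow> nat \<Rightarrow> nat" where
  "err T w m = (\<Sum>l<depth T m. mism T (w * 2 ^ l) (m * 2 ^ l) (2 ^ l))"

text \<open>The left ends of the levels double, so those inside the table form a finite initial
  segment, which \<open>depth\<close> counts.\<close>

lemma depth:
  assumes "0 < m"
  shows "length T < m * 2 ^ depth T m" "l < depth T m \<longleftrightarrow> m * 2 ^ l \<le> length T"
proof -
  have "length T < 2 ^ length T" by (rule less_exp)
  also have "\<dots> \<le> m * 2 ^ length T" using assms by simp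
  finally show *: "length T < m * 2 ^ depth T m"
    unfolding depth_def by (rule LeastI)
  show "l < depth T m \<longleftrightarrow> m * 2 ^ l \<le> length T"
  proof
    assume "l < depth T m"
    then show "m * 2 ^ l \<le> length T" unfolding depth_def using not_less_Least leI by blast
  next
    assume l: "m * 2 ^ l \<le> length T"
    show "l < depth T m"
    proof (rule ccontr)
      assume "\<not> l < depth T m"
      then have "m * 2 ^ depth T m \<le> m * 2 ^ l" by (simp add: power_increasing)
      with * l show False by linarith
    qed
  qed
qed

lemma err_eq_0_iff:
  assumes "0 < m"
  shows "err T w m = 0 \<longleftrightarrow> agree T w m"
  by (auto simp: err_def agree_def mism_def depth(2)[OF assms] split: if_splits)

lemma agree_refl: "agree T m m"
  by (simp add: agree_def)

text \<open>Position \<open>m\<close> agrees with itself, so a least candidate exists and the search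
  ends at \<open>m\<close> at the latest.\<close>

lemma rep:
  assumes "0 < m"
  shows "0 < rep T m" "agree T (rep T m) m" "rep T m \<le> m"
    and "0 < w \<Longrightarrow> w < rep T m \<Longrightarrow> \<not> agree T w m"
proof -
  have *: "0 < m \<and> agree T m m" using assms agree_refl by blast
  show "0 < rep T m" "agree T (rep T m) m" "rep T m \<le> m"
    unfolding rep_def using LeastI[where P = "\<lambda>w. 0 < w \<and> agree T w m", OF *]
      Least_le[where P = "\<lambda>w. 0 < w \<and> agree T w m", OF *] by auto
  show "0 < w \<Longrightarrow> w < rep T m \<Longrightarrow> \<not> agree T w m"
    unfolding rep_def using not_less_Least by blast
qed

lemma exec_advance: "exec 10 advance (conf w h T R o') (conf w (Suc h) T R o')"
  unfolding advance_def
  by (rule exec_ActI, unfold perform_move) (auto simp: conf_def)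

definition state_code :: "nat list \<Rightarrow> nat \<Rightarrow> nat list" where
  "state_code T n =
     bits (unary (rep T (2 * n) - 1)) @ bits (unary (rep T (2 * n + 1) - 1)) @ [sym T n]"

section \<open>Matching, searching and listing the states\<close>

context
  fixes T :: "nat list"
  assumes T: "labels T"
begin

lemma exec_match:
  assumes "R 4 = 0" "R 5 = 0" "R 6 = 0" "R 7 = 0" "R 8 = 0" "0 < R 2"
  shows "exec 10 match (conf w h T R o') (conf w h T (R(8 := err T (R 3) (R 2))) o')"
proof -
  let ?C = "\<lambda>R. conf w h T R o'"
  let ?m = "R 2" and ?w = "R 3"
  let ?S = "\<lambda>k. R(4 := ?w * 2 ^ k, 5 := ?m * 2 ^ k, 6 := 2 ^ k,
    8 := \<Sum>l<k. mism T (?w * 2 ^ l) (?m * 2 ^ l) (2 ^ l))"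
  have 1: "exec 10 (copy 3 4) (?C R) (?C (R(4 := ?w)))"
    using exec_copy[OF T, of 3 4 R w h o'] assms by simp
  have 2: "exec 10 (copy 2 5) (?C (R(4 := ?w))) (?C (R(4 := ?w, 5 := ?m)))"
    using exec_copy[OF T, of 2 5 "R(4 := ?w)" w h o'] assms by simp
  have 3: "exec 10 (adjust (\<lambda>_. {6}) {}) (?C (R(4 := ?w, 5 := ?m))) (?C (?S 0))"
    by (rule exec_adjust[OF refl]) (use assms in auto)
  \<comment> \<open>By the choice of \<open>depth\<close>, register \<open>5\<close>, the left end
    of the level below \<open>?m\<close>, first reads blank after \<open>depth T ?m\<close>
    rounds.\<close>
  have 4: "exec 10 (While (\<lambda>rs. rs ! 5 \<noteq> 0) (compare_block ;; double 4 ;; double 5 ;; double 6))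
      (?C (?S 0)) (?C (?S (depth T ?m)))"
  proof (rule exec_While_seq[where S = "\<lambda>k. ?C (?S k)" and n = "depth T ?m"])
    fix k assume k: "k < depth T ?m"
    let ?X = "(?S k)(8 := \<Sum>l<Suc k. mism T (?w * 2 ^ l) (?m * 2 ^ l) (2 ^ l))"
    have c1: "exec 10 compare_block (?C (?S k)) (?C ?X)"
      using exec_compare_block[OF T, of "?S k" w h o'] assms by simp
    have c2: "exec 10 (double 4) (?C ?X) (?C (?X(4 := ?w * 2 ^ Suc k)))"
      using exec_double[OF T, of 4 ?X w h o'] assms by (simp add: mult.left_commute)
    have c3: "exec 10 (double 5) (?C (?X(4 := ?w * 2 ^ Suc k)))
        (?C (?X(4 := ?w * 2 ^ Suc k, 5 := ?m * 2 ^ Suc k)))"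
      using exec_double[OF T, of 5 "?X(4 := ?w * 2 ^ Suc k)" w h o'] assms
      by (simp add: mult.left_commute)
    have c4: "exec 10 (double 6) (?C (?X(4 := ?w * 2 ^ Suc k, 5 := ?m * 2 ^ Suc k)))
        (?C (?X(4 := ?w * 2 ^ Suc k, 5 := ?m * 2 ^ Suc k, 6 := 2 ^ Suc k)))"
      using exec_double[OF T, of 6 "?X(4 := ?w * 2 ^ Suc k, 5 := ?m * 2 ^ Suc k)" w h o'] assms
      by simp
    have X: "?X(4 := ?w * 2 ^ Suc k, 5 := ?m * 2 ^ Suc k, 6 := 2 ^ Suc k) = ?S (Suc k)"
      by (auto simp: fun_eq_iff)
    show "exec 10 (compare_block ;; double 4 ;; double 5 ;; double 6)
        (?C (?S k)) (?C (?S (Suc k)))"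
      using c1 c2 c3 c4 unfolding X by (intro exec.Seq)
  qed (use depth[OF assms(6)] sym_labels[OF T] in \<open>auto simp: not_less\<close>)
  let ?k = "depth T ?m"
  have 5: "exec 10 (clear 4) (?C (?S ?k)) (?C ((?S ?k)(4 := 0)))"
    "exec 10 (clear 5) (?C ((?S ?k)(4 := 0))) (?C ((?S ?k)(4 := 0, 5 := 0)))"
    "exec 10 (clear 6) (?C ((?S ?k)(4 := 0, 5 := 0))) (?C ((?S ?k)(4 := 0, 5 := 0, 6 := 0)))"
    by (rule exec_clear[OF T]; simp)+
  have R: "(?S ?k)(4 := 0, 5 := 0, 6 := 0) = R(8 := err T ?w ?m)"
    using assms by (auto simp: fun_eq_iff err_def)
  show ?thesis
    unfolding match_def using 1 2 3 4 5[unfolded R] by (intro exec.Seq)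
qed

lemma exec_search:
  assumes "R 3 = 0" "R 4 = 0" "R 5 = 0" "R 6 = 0" "R 7 = 0" "R 8 = 0" "0 < R 2"
  shows "exec 10 search (conf w h T R o')
    (conf w h T R (o' @ bits (unary (rep T (R 2) - 1))))"
proof -
  let ?C = "conf w h T"
  let ?m = "R 2"
  let ?k = "rep T ?m - 1"
  \<comment> \<open>After \<open>i\<close> rejections the candidate \<open>Suc i\<close> has been
    tested; \<open>Suc ?k\<close> is \<open>rep T ?m\<close>, the first that agrees.\<close>
  let ?S = "\<lambda>i. ?C (R(3 := Suc i, 8 := err T (Suc i) ?m)) (o' @ replicate i 2)"
  note rep = rep[OF assms(7), where T = T]
  have 1: "exec 10 (adjust (\<lambda>_. {3}) {}) (?C R o') (?C (R(3 := 1)) o')"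
    by (rule exec_adjust[OF refl]) (use assms in auto)
  have 2: "exec 10 match (?C (R(3 := 1)) o') (?S 0)"
    using exec_match[of "R(3 := 1)" w h o'] assms by simp
  have 3: "exec 10 (While (\<lambda>rs. rs ! 8 \<noteq> 3) (emit (\<lambda>_. 2) ;; clear 8 ;; adjust (\<lambda>_. {3}) {} ;; match))
      (?S 0) (?S ?k)"
  proof (rule exec_While_seq[where S = ?S and n = ?k])
    fix i assume i: "i < ?k"
    show "reads 10 (?S i) ! 8 \<noteq> 3"
      using rep(4)[of "Suc i"] i by (simp add: sym_labels[OF T] err_eq_0_iff[OF assms(7)] less_diff_conv)
    have c1: "exec 10 (emit (\<lambda>_. 2)) (?S i) (?C (R(3 := Suc i, 8 := err T (Suc i) ?m)) (o' @ replicate (Suc i) 2))"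
      using exec_emit[of "\<lambda>_. 2" w h T _ "o' @ replicate i 2"] by (simp add: replicate_append_same)
    have c2: "exec 10 (clear 8) \<dots> (?C (R(3 := Suc i)) (o' @ replicate (Suc i) 2))"
      using exec_clear[OF T, of 8 w h "R(3 := Suc i, 8 := err T (Suc i) ?m)"] assms
      by (simp add: fun_upd_idem)
    have c3: "exec 10 (adjust (\<lambda>_. {3}) {}) \<dots> (?C (R(3 := Suc (Suc i))) (o' @ replicate (Suc i) 2))"
      by (rule exec_adjust[OF refl]) auto
    have c4: "exec 10 match \<dots> (?S (Suc i))"
      using exec_match[of "R(3 := Suc (Suc i))" w h] assms by simp
    show "exec 10 (emit (\<lambda>_. 2) ;; clear 8 ;; adjust (\<lambda>_. {3}) {} ;; match) (?S i) (?S (Suc i))"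
      using c1 c2 c3 c4 by (intro exec.Seq)
  next
    show "\<not> reads 10 (?S ?k) ! 8 \<noteq> 3"
      using rep(1,2) by (simp add: sym_labels[OF T] err_eq_0_iff[OF assms(7)])
  qed auto
  \<comment> \<open>The accepted candidate leaves \<open>8\<close> at zero, so only \<open>3\<close>
    remains to be cleared.\<close>
  have k: "err T (Suc ?k) ?m = 0"
    using rep(1,2) by (simp add: err_eq_0_iff[OF assms(7)])
  have 4: "exec 10 (emit (\<lambda>_. 1)) (?S ?k) (?C (R(3 := Suc ?k, 8 := 0)) (o' @ replicate ?k 2 @ [1]))"
    using exec_emit[of "\<lambda>_. 1" w h T _ "o' @ replicate ?k 2"] unfolding k by simp
  have 5: "exec 10 (clear 3) \<dots> (?C (R(3 := Suc ?k, 8 := 0, 3 := 0)) (o' @ replicate ?k 2 @ [1]))"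
    by (rule exec_clear[OF T]) simp_all
  have R: "R(3 := Suc ?k, 8 := 0, 3 := 0) = R"
    using assms by (auto simp: fun_eq_iff)
  have code: "replicate ?k 2 @ [1] = bits (unary ?k)"
    by (simp add: bits_def unary_def)
  show ?thesis
    unfolding search_def using 1 2 3 4[unfolded code] 5[unfolded R code] by (intro exec.Seq)
qed

lemma exec_states:
  assumes "\<And>j. 0 < j \<Longrightarrow> j < 9 \<Longrightarrow> R j = 0"
  shows "\<exists>R'. exec 10 states (conf w h T R o')
    (conf w h T R' (o' @ concat (map (state_code T) [1..<Suc (length T)])))"
proof -
  let ?C = "conf w h T"
  let ?S = "\<lambda>i. ?C (R(1 := Suc i, 2 := 2 * Suc i)) (o' @ concat (map (state_code T) [1..<Suc i]))"
  have R: "R 3 = 0" "R 4 = 0" "R 5 = 0" "R 6 = 0" "R 7 = 0" "R 8 = 0"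
    using assms by simp_all
  have 1: "exec 10 (adjust (\<lambda>_. {1, 2}) {}) (?C R o') (?C (R(1 := 1, 2 := 1)) o')"
    by (rule exec_adjust[OF refl]) (use assms in auto)
  have 2: "exec 10 (adjust (\<lambda>_. {2}) {}) \<dots> (?S 0)"
    by (simp, rule exec_adjust[OF refl]) auto
  let ?body = "search ;; adjust (\<lambda>_. {2}) {} ;; search ;; adjust (\<lambda>_. {2}) {} ;; emit (\<lambda>rs. rs ! 1) ;;
        adjust (\<lambda>_. {1}) {}"
  have 3: "exec 10 (While (\<lambda>rs. rs ! 1 \<noteq> 0) ?body) (?S 0) (?S (length T))"
  proof (rule exec_While_seq[where S = ?S and n = "length T"])
    fix i assume i: "i < length T"
    show "reads 10 (?S i) ! 1 \<noteq> 0"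
      using i by (simp add: sym_labels[OF T])
    let ?n = "Suc i" and ?o = "o' @ concat (map (state_code T) [1..<Suc i])"
    let ?o1 = "?o @ bits (unary (rep T (2 * ?n) - 1))"
    let ?o2 = "?o1 @ bits (unary (rep T (2 * ?n + 1) - 1))"
    have c1: "exec 10 search (?S i) (?C (R(1 := ?n, 2 := 2 * ?n)) ?o1)"
      using exec_search[of "R(1 := ?n, 2 := 2 * ?n)" w h ?o] R by simp
    have c2: "exec 10 (adjust (\<lambda>_. {2}) {}) \<dots> (?C (R(1 := ?n, 2 := 2 * ?n + 1)) ?o1)"
      by (rule exec_adjust[OF refl]) auto
    have c3: "exec 10 search \<dots> (?C (R(1 := ?n, 2 := 2 * ?n + 1)) ?o2)"
      using exec_search[of "R(1 := ?n, 2 := 2 * ?n + 1)" w h ?o1] R by simp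
    have c4: "exec 10 (adjust (\<lambda>_. {2}) {}) \<dots> (?C (R(1 := ?n, 2 := 2 * ?n + 2)) ?o2)"
      by (rule exec_adjust[OF refl]) auto
    have c5: "exec 10 (emit (\<lambda>rs. rs ! 1)) \<dots> (?C (R(1 := ?n, 2 := 2 * ?n + 2)) (?o2 @ [sym T ?n]))"
      by (rule exec_emit) simp
    have c6: "exec 10 (adjust (\<lambda>_. {1}) {}) \<dots>
        (?C (R(1 := Suc ?n, 2 := 2 * Suc ?n)) (?o2 @ [sym T ?n]))"
      by (rule exec_adjust[OF refl]) auto
    have o2: "?o2 @ [sym T ?n] = o' @ concat (map (state_code T) [1..<Suc (Suc i)])"
      by (simp add: state_code_def)
    have "exec 10 ?body (?S i) (?C (R(1 := Suc ?n, 2 := 2 * Suc ?n)) (?o2 @ [sym T ?n]))"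
      using c1 c2 c3 c4 c5 c6 by (intro exec.Seq)
    then show "exec 10 ?body (?S i) (?S (Suc i))"
      unfolding o2 .
  qed (auto simp: sym_labels[OF T])
  show ?thesis
    unfolding states_def by (intro exI) (rule exec.Seq[OF 1 exec.Seq[OF 2 3]])
qed

end

section \<open>Reading the sample\<close>

definition encode_entry :: "bool list \<times> bool \<Rightarrow> nat list" where
  "encode_entry e = bits (fst e) @ [3] @ bits [snd e] @ [3]"

lemma table_append: "(table T)(int (Suc (length T)) := a) = table (T @ [a])"
  by (auto simp: table_def sym_def fun_eq_iff nth_append)

lemma exec_record_label:
  assumes "\<And>j. 0 < j \<Longrightarrow> j < 9 \<Longrightarrow> R j = Suc (length T)" "h < length w"
  shows "exec 10 record_label (conf w h T R o')
    (conf w (Suc h) (T @ [w ! h]) (\<lambda>j. Suc (R j)) (o' @ [2]))"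
  unfolding record_label_def
proof (rule exec_ActI)
  let ?f = "\<lambda>rs j. (if j = 0 then rs ! 0 else if j = 9 then 2 else rs ! 0, Rgt)"
  have *: "(cells w)(int h := w ! h) = cells w"
    using assms(2) by (auto simp: cells_def)
  show "perform 10 ?f (conf w h T R o') =
      conf w (Suc h) (T @ [w ! h]) (\<lambda>j. Suc (R j)) (o' @ [2])"
  proof
    fix j
    have "reads 10 (conf w h T R o') ! 0 = w ! h" using assms(2) by simp
    then show "perform 10 ?f (conf w h T R o') j =
        conf w (Suc h) (T @ [w ! h]) (\<lambda>j. Suc (R j)) (o' @ [2]) j"
      using assms(1)[of j] table_append[of T "w ! h"] cells_append[of o' 2] *
      by (auto simp: perform_eq) (auto simp: conf_def add.commute)
  qed
qed

lemma exec_entry: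
  assumes "w = us @ encode_entry (x, y) @ vs"
  shows "exec 10 (While (\<lambda>rs. rs ! 0 \<noteq> 3) advance ;; advance ;; record_label ;; advance)
    (conf w (length us) T (\<lambda>_. Suc (length T)) o')
    (conf w (length (us @ encode_entry (x, y))) (T @ bits [y]) (\<lambda>_. Suc (Suc (length T))) (o' @ [2]))"
proof -
  let ?R = "\<lambda>_. Suc (length T)"
  let ?h = "length us + length x"
  have w: "w = us @ bits x @ [3] @ bits [y] @ [3] @ vs" using assms by (simp add: encode_entry_def)
  have len: "length (bits x) = length x" by (simp add: bits_def)
  have c1: "exec 10 (While (\<lambda>rs. rs ! 0 \<noteq> 3) advance) (conf w (length us) T ?R o') (conf w ?h T ?R o')"
  proof (rule exec_While_seq[where S = "\<lambda>i. conf w (length us + i) T ?R o'" and n = "length x"])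
    fix i assume "i < length x"
    then show "reads 10 (conf w (length us + i) T ?R o') ! 0 \<noteq> 3"
      by (simp add: w nth_append len) (simp add: bits_def)
  next
    show "\<not> reads 10 (conf w (length us + length x) T ?R o') ! 0 \<noteq> 3"
      by (simp add: w nth_append len)
  qed (simp_all add: exec_advance)
  have c2: "exec 10 advance (conf w ?h T ?R o') (conf w (Suc ?h) T ?R o')"
    by (rule exec_advance)
  have c3: "exec 10 record_label (conf w (Suc ?h) T ?R o')
      (conf w (Suc (Suc ?h)) (T @ bits [y]) (\<lambda>_. Suc (Suc (length T))) (o' @ [2]))"
  proof -
    have "w ! Suc ?h = hd (bits [y])" "Suc ?h < length w"
      by (simp_all add: w nth_append len bits_def)
    then show ?thesis
      using exec_record_label[of ?R T "Suc ?h" w o'] by (simp add: bits_def)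
  qed
  have c4: "exec 10 advance \<dots>
      (conf w (Suc (Suc (Suc ?h))) (T @ bits [y]) (\<lambda>_. Suc (Suc (length T))) (o' @ [2]))"
    by (rule exec_advance)
  have len3: "Suc (Suc (Suc ?h)) = length (us @ encode_entry (x, y))"
    by (simp add: encode_entry_def bits_def)
  show ?thesis
    by (rule exec.Seq[OF c1 exec.Seq[OF c2 exec.Seq[OF c3 c4[unfolded len3]]]])
qed

lemma exec_mark: "exec 10 mark (init_store w) (conf w 0 [] (\<lambda>_. 1) [])"
  unfolding mark_def
proof (rule exec_ActI, rule ext)
  fix j
  let ?f = "\<lambda>rs j. if 0 < j \<and> j < 9 then (3, Rgt) else (rs ! j, Stay)"
  have *: "table [] = (\<lambda>_. 0)(0 := 3)" "cells [] = (\<lambda>_. 0)"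
    by (auto simp: table_def sym_def cells_def)
  have "cells w = snd (input_tape w)"
    by (auto simp: cells_def input_tape_def)
  then show "perform 10 ?f (init_store w) j = conf w 0 [] (\<lambda>_. 1) [] j"
    by (auto simp: perform_def init_store_def conf_def * blank_tape_def reads_def input_tape_def
        fun_eq_iff)
qed

lemma exec_read_sample:
  fixes es :: "(bool list \<times> bool) list"
  defines "w \<equiv> concat (map encode_entry es)" and "T \<equiv> bits (map snd es)"
  shows "\<exists>R. (\<forall>j. 0 < j \<longrightarrow> j < 9 \<longrightarrow> R j = 0) \<and>
    exec 10 read_sample (init_store w)
      (conf w (length w) T R (replicate (length es) 2 @ [1, 1]))"
proof -
  let ?n = "length es"
  let ?S = "\<lambda>i. conf w (length (concat (map encode_entry (take i es)))) (bits (map snd (take i es)))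
    (\<lambda>_. Suc i) (replicate i 2)"
  have T: "labels T" by (auto simp: labels_def T_def bits_def)
  have len: "length T = ?n" by (simp add: T_def bits_def)
  have 1: "exec 10 mark (init_store w) (?S 0)"
    using exec_mark[of w] by (simp add: bits_def)
  have 2: "exec 10 (While (\<lambda>rs. rs ! 0 \<noteq> 0)
      (While (\<lambda>rs. rs ! 0 \<noteq> 3) advance ;; advance ;; record_label ;; advance)) (?S 0) (?S ?n)"
  proof (rule exec_While_seq[where S = ?S and n = ?n])
    fix i assume i: "i < ?n"
    obtain x y where xy: "es ! i = (x, y)" by fastforce
    let ?us = "concat (map encode_entry (take i es))"
    have "es = take i es @ (x, y) # drop (Suc i) es"
      using i xy id_take_nth_drop by metis
    then have w: "w = ?us @ encode_entry (x, y) @ concat (map encode_entry (drop (Suc i) es))"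
      unfolding w_def by (metis concat.simps(2) concat_append list.simps(9) map_append)
    have tk: "take (Suc i) es = take i es @ [(x, y)]"
      using i xy by (simp add: take_Suc_conv_app_nth)
    \<comment> \<open>Even for the empty word an entry starts with a nonblank, the separator, so the
      loop does not stop early.\<close>
    have "encode_entry (x, y) ! 0 \<noteq> 0" "0 < length (encode_entry (x, y))"
      by (cases x; simp add: encode_entry_def bits_def)+
    then have "w ! length ?us \<noteq> 0" "length ?us < length w"
      by (simp_all add: w nth_append)
    then show "reads 10 (?S i) ! 0 \<noteq> 0" by simp
    show "exec 10 (While (\<lambda>rs. rs ! 0 \<noteq> 3) advance ;; advance ;; record_label ;; advance)
        (?S i) (?S (Suc i))"
      using exec_entry[OF w, of "bits (map snd (take i es))" "replicate i 2"] i
      by (simp add: tk bits_def replicate_append_same)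
  qed (simp_all add: w_def)
  have 3: "exec 10 (emit (\<lambda>_. 1)) (?S ?n)
      (conf w (length w) T (\<lambda>_. Suc ?n) (replicate ?n 2 @ [1]))"
    using exec_emit[of "\<lambda>_. 1" w "length w" T "\<lambda>_. Suc ?n"] by (simp add: w_def T_def)
  have 4: "exec 10 (emit (\<lambda>_. 1)) \<dots> (conf w (length w) T (\<lambda>_. Suc ?n) (replicate ?n 2 @ [1, 1]))"
    using exec_emit[of "\<lambda>_. 1" w "length w" T "\<lambda>_. Suc ?n" "replicate ?n 2 @ [1]"] by simp
  \<comment> \<open>The register heads move in step, so testing tape \<open>1\<close> brings all of
    them back to the mark.\<close>
  have 5: "exec 10 (While (\<lambda>rs. rs ! 1 \<noteq> 3) (adjust (\<lambda>_. {}) {1..8})) \<dots>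
      (conf w (length w) T (\<lambda>_. 0) (replicate ?n 2 @ [1, 1]))"
    by (rule exec_While_seq[where n = "Suc ?n" and
          S = "\<lambda>i. conf w (length w) T (\<lambda>_. Suc ?n - i) (replicate ?n 2 @ [1, 1])"])
      (auto simp: sym_labels[OF T] intro!: exec_adjust[OF refl])
  show ?thesis
    unfolding read_sample_def
    using exec.Seq[OF 1 exec.Seq[OF 2 exec.Seq[OF 3 exec.Seq[OF 4 5]]]]
    by (intro exI[of _ "\<lambda>_. 0"]) simp
qed

lemma halts_with_learner:
  fixes es :: "(bool list \<times> bool) list"
  defines "T \<equiv> bits (map snd es)"
  shows "halts_with (machine 10 learner) (concat (map encode_entry es))
    (bits (unary (length es)) @ bits (unary 0) @ concat (map (state_code T) [1..<Suc (length es)]))"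
proof -
  let ?w = "concat (map encode_entry es)"
  let ?v = "bits (unary (length es)) @ bits (unary 0) @ concat (map (state_code T) [1..<Suc (length es)])"
  have T: "labels T" by (auto simp: labels_def T_def bits_def)
  have len: "length T = length es" by (simp add: T_def bits_def)
  obtain R where R: "\<And>j. 0 < j \<Longrightarrow> j < 9 \<Longrightarrow> R j = 0"
    and 1: "exec 10 read_sample (init_store ?w)
      (conf ?w (length ?w) T R (replicate (length es) 2 @ [1, 1]))"
    using exec_read_sample[of es] unfolding T_def by blast
  obtain R' where 2: "exec 10 states (conf ?w (length ?w) T R (replicate (length es) 2 @ [1, 1]))
      (conf ?w (length ?w) T R' ((replicate (length es) 2 @ [1, 1]) @
        concat (map (state_code T) [1..<Suc (length es)])))"
    by (rule exE[OF exec_states[OF T R, unfolded len]])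
  have v: "(replicate (length es) 2 @ [1, 1]) @ concat (map (state_code T) [1..<Suc (length es)]) = ?v"
    by (simp add: bits_def unary_def)
  have "0 \<notin> set (bits p)" for p by (auto simp: bits_def)
  moreover have "sym T n \<noteq> 0" if "n < Suc (length es)" for n
    using that by (simp add: sym_labels[OF T] len)
  ultimately have "0 \<notin> set (state_code T n)" if "n < Suc (length es)" for n
    using that by (auto simp: state_code_def)
  then have "0 \<notin> set ?v"
    using \<open>\<And>p. 0 \<notin> set (bits p)\<close> by auto
  moreover have "holds_word (conf w h T R o' 9) o'" if "0 \<notin> set o'" for w h T R o'
    using that by (simp add: holds_word_def conf_def cells_def)
  ultimately have "holds_word (conf ?w (length ?w) T R' ?v 9) ?v"
    by blast
  moreover have "exec 10 learner (init_store ?w) (conf ?w (length ?w) T R' ?v)"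
    unfolding learner_def using 1 2 unfolding v by (rule exec.Seq)
  ultimately show ?thesis by (intro halts_with_machine) simp_all
qed

section \<open>Distinguishing the states of an automaton\<close>

text \<open>Equality of signatures is the \<open>k\<close>-th equivalence of Moore's
  algorithm.\<close>

definition signature :: "dfa \<Rightarrow> nat \<Rightarrow> nat \<Rightarrow> bool list set" where
  "signature B k q = {v. length v \<le> k \<and> foldl (delta B) q v \<in> final B}"

lemma signature_Suc_step:
  assumes "signature B (Suc k) p = signature B (Suc k) q"
  shows "signature B k (delta B p b) = signature B k (delta B q b)"
proof -
  have "v \<in> signature B k (delta B r b) \<longleftrightarrow> b # v \<in> signature B (Suc k) r" for v r
    by (simp add: signature_def)
  then show ?thesis using assms by blast
qed

lemma signature_mono:
  assumes "signature B l p = signature B l q" "k \<le> l"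
  shows "signature B k p = signature B k q"
proof -
  have "signature B k r = signature B l r \<inter> {v. length v \<le> k}" for r
    using assms(2) by (auto simp: signature_def)
  then show ?thesis using assms(1) by simp
qed

text \<open>Moore's partition refinement: each round splits a class until the partition is stable, so
  the words of length at most \<open>c - 2\<close> separate all inequivalent states.\<close>

lemma distinguishing_length:
  assumes B: "is_dfa B" and p: "p < num_states B" and q: "q < num_states B"
    and agree: "\<And>v. length v + 2 \<le> num_states B \<Longrightarrow>
      foldl (delta B) p v \<in> final B \<longleftrightarrow> foldl (delta B) q v \<in> final B"
  shows "foldl (delta B) p v \<in> final B \<longleftrightarrow> foldl (delta B) q v \<in> final B"
proof (cases "num_states B \<ge> 2")
  case False
  then have "p = q" using p q by linarith
  then show ?thesis by simp
next
  case True
  let ?c = "num_states B" and ?Q = "{..<num_states B}"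
  let ?sig = "signature B"
  define stable where "stable k \<longleftrightarrow> (\<forall>r \<in> ?Q. \<forall>s \<in> ?Q. ?sig k r = ?sig k s \<longrightarrow> ?sig (Suc k) r = ?sig (Suc k) s)" for k
  have closed: "r \<in> ?Q \<Longrightarrow> delta B r b \<in> ?Q" for r b
    using B by (simp add: is_dfa_def)
  \<comment> \<open>A longer word is a letter followed by a word read from the successors, and
    stability passes equality of signatures on to the successors.\<close>
  have stable_forever: "?sig l r = ?sig l s" if "stable k" "r \<in> ?Q" "s \<in> ?Q" "?sig k r = ?sig k s" for k l r s
  proof -
    have "?sig (k + n) r = ?sig (k + n) s" if "r \<in> ?Q" "s \<in> ?Q" "?sig k r = ?sig k s" for n r s
      using that
    proof (induction n arbitrary: r s)
      case (Suc n)
      have 1: "?sig (Suc k) r = ?sig (Suc k) s"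
        using \<open>stable k\<close> Suc.prems unfolding stable_def by blast
      have "?sig (k + n) (delta B r b) = ?sig (k + n) (delta B s b)" for b
        using Suc.IH[OF closed closed] Suc.prems(1,2) signature_Suc_step[OF 1] by blast
      moreover have "[] \<in> ?sig (Suc k) r \<longleftrightarrow> [] \<in> ?sig (Suc k) s" using 1 by simp
      moreover have "v \<in> ?sig (Suc (k + n)) t \<longleftrightarrow>
          (case v of [] \<Rightarrow> [] \<in> ?sig (Suc k) t | b # u \<Rightarrow> u \<in> ?sig (k + n) (delta B t b))" for v t
        by (cases v) (simp_all add: signature_def)
      ultimately show ?case by (auto split: list.splits)
    qed simp
    \<comment> \<open>Equality at level \<open>k + l\<close> is restricted to \<open>l\<close>,
      which covers \<open>l < k\<close> as well.\<close>
    from this[OF that(2-4), of l] show ?thesis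
      by (rule signature_mono) simp
  qed
  define classes where "classes k = card (?sig k ` ?Q)" for k
  have image: "?sig k ` ?Q = (\<lambda>S. S \<inter> {v. length v \<le> k}) ` ?sig (Suc k) ` ?Q" for k
    by (force simp: signature_def image_image intro!: image_cong)
  \<comment> \<open>Truncation maps the classes at level \<open>Suc k\<close> onto those at level
    \<open>k\<close>; equal numbers make it injective, and that is stability.\<close>
  have grow: "classes k < classes (Suc k)" if "\<not> stable k" for k
  proof (rule ccontr)
    assume "\<not> classes k < classes (Suc k)"
    moreover have "classes k \<le> classes (Suc k)"
      unfolding classes_def image[of k] by (rule card_image_le) simp
    ultimately have "inj_on (\<lambda>S. S \<inter> {v. length v \<le> k}) (?sig (Suc k) ` ?Q)"
      unfolding classes_def image[of k] by (intro eq_card_imp_inj_on) auto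
    moreover have "?sig k r = ?sig (Suc k) r \<inter> {v. length v \<le> k}" for r
      by (auto simp: signature_def)
    ultimately have "stable k" unfolding stable_def by (auto dest: inj_onD)
    with that show False ..
  qed
  show ?thesis
  proof (rule ccontr)
    assume neq: "\<not> ?thesis"
    then have neq: "?sig (length v) p \<noteq> ?sig (length v) q"
      by (auto simp: signature_def)
    have eq: "?sig (?c - 2) p = ?sig (?c - 2) q"
      using agree True by (auto simp: signature_def)
    \<comment> \<open>A stable level up to \<open>?c - 2\<close> would identify \<open>p\<close> and
      \<open>q\<close> on all words, including the separating word \<open>v\<close>.\<close>
    have unstable: "\<not> stable k" if "k \<le> ?c - 2" for k
      using stable_forever[of k p q "length v"] signature_mono[OF eq that] neq p q by auto
    \<comment> \<open>Two classes at level \<open>0\<close> and a new one at each level up to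
      \<open>?c - 1\<close> give more classes than states.\<close>
    have "k + 1 < classes k" if "k \<le> ?c - 1" for k
      using that
    proof (induction k)
      case 0
      have "classes 0 \<noteq> 0" using p by (auto simp: classes_def)
      \<comment> \<open>If all states agreed on acceptance, no word could separate \<open>p\<close>
        from \<open>q\<close>.\<close>
      moreover have "classes 0 \<noteq> 1"
      proof
        assume "classes 0 = 1"
        then obtain S where S: "?sig 0 ` ?Q = {S}" unfolding classes_def by (metis card_1_singletonE)
        have "[] \<in> ?sig 0 r \<longleftrightarrow> [] \<in> S" if "r \<in> ?Q" for r using S that by blast
        then have acc: "r \<in> final B \<longleftrightarrow> [] \<in> S" if "r \<in> ?Q" for r
          using that by (simp add: signature_def)
        have "foldl (delta B) r u \<in> ?Q" if "r \<in> ?Q" for r u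
          using that closed by (induction u arbitrary: r) auto
        then have "?sig (length v) p = ?sig (length v) q"
          using acc p q by (auto simp: signature_def)
        with neq show False ..
      qed
      ultimately show ?case by simp
    next
      case (Suc k)
      then have "k + 1 < classes k" "classes k < classes (Suc k)"
        using grow[OF unstable[of k]] by simp_all
      then show ?case by simp
    qed
    from this[of "?c - 1"] have "?c < classes (?c - 1)" using True by simp
    moreover have "classes (?c - 1) \<le> ?c"
      unfolding classes_def using card_image_le[of ?Q] by fastforce
    ultimately show False by simp
  qed
qed

text \<open>A walk that repeats a state can be shortened.\<close>

lemma short_access:
  assumes B: "is_dfa B"
  shows "\<exists>u. length u < num_states B \<and> foldl (delta B) (start B) u = foldl (delta B) (start B) x"
proof (induction x rule: length_induct)
  case (1 x)
  let ?run = "\<lambda>i. foldl (delta B) (start B) (take i x)"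
  show ?case
  proof (cases "length x < num_states B")
    case False
    have "foldl (delta B) (start B) u < num_states B" for u
      using B by (induction u rule: rev_induct) (simp_all add: is_dfa_def)
    then have "card (?run ` {..length x}) \<le> num_states B"
      using card_mono[of "{..<num_states B}" "?run ` {..length x}"] by auto
    \<comment> \<open>Pigeonhole: \<open>x\<close> has more prefixes than there are states, and the
      segment between two prefixes reaching the same state can be cut out.\<close>
    then have "\<not> inj_on ?run {..length x}"
      using False card_image[of ?run "{..length x}"] by auto
    then obtain i j where ij: "i < j" "j \<le> length x" "?run i = ?run j"
      unfolding inj_on_def by (metis atMost_iff linorder_neqE_nat)
    have "foldl (delta B) (start B) (take i x @ drop j x) =
        foldl (delta B) (start B) (take j x @ drop j x)"
      using ij(3) unfolding foldl_append by simp
    then have "foldl (delta B) (start B) (take i x @ drop j x) = foldl (delta B) (start B) x"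
      by simp
    moreover have "length (take i x @ drop j x) < length x" using ij by simp
    ultimately show ?thesis using 1 by metis
  qed blast
qed

section \<open>Binary words as heap positions\<close>

text \<open>The bits of \<open>v\<close> are appended to \<open>n\<close> in binary. Thus
  \<open>heap 1 v\<close> is the position of the word \<open>v\<close>, with the empty word at
  \<open>1\<close>, and \<open>heap 0 v\<close> is its offset within its level.\<close>

definition heap :: "nat \<Rightarrow> bool list \<Rightarrow> nat" where
  "heap n v = foldl (\<lambda>n b. 2 * n + of_bool b) n v"

lemma heap_simps [simp]:
  "heap n [] = n" "heap n (v @ [b]) = 2 * heap n v + of_bool b" "heap n (u @ v) = heap (heap n u) v"
  by (simp_all add: heap_def)

lemma heap_eq: "heap n v = n * 2 ^ length v + heap 0 v"
  by (induction v rule: rev_induct) (simp_all del: heap_simps(3))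

lemma heap_0_less: "heap 0 v < 2 ^ length v"
  by (induction v rule: rev_induct) (auto simp del: heap_simps(3))

lemma heap_0_surj: "i < 2 ^ l \<Longrightarrow> \<exists>v. length v = l \<and> heap 0 v = i"
proof (induction l arbitrary: i)
  case (Suc l)
  then obtain v where "length v = l" "heap 0 v = i div 2"
    by (metis less_mult_imp_div_less mult.commute power_Suc)
  then show ?case
    by (intro exI[of _ "v @ [odd i]"]) (simp del: heap_simps(3))
qed simp

lemma heap_0_inj: "length u = length v \<Longrightarrow> heap 0 u = heap 0 v \<Longrightarrow> u = v"
proof (induction u arbitrary: v rule: rev_induct)
  case (snoc a u)
  then obtain v' b where v: "v = v' @ [b]" by (cases v rule: rev_cases) auto
  have *: "2 * heap 0 u + of_bool a = 2 * heap 0 v' + of_bool b"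
    using snoc.prems(2) unfolding v heap_simps(2) .
  have "a = b" using arg_cong[OF *, of even] by (cases a; cases b) simp_all
  moreover from this have "heap 0 u = heap 0 v'" using * by simp
  ultimately show ?case using snoc v by simp
qed simp

text \<open>The leading \<open>1\<close> gives \<open>heap 1 v\<close> exactly
  \<open>length v + 1\<close> binary digits.\<close>

lemma heap_less_power_iff: "heap 1 v < 2 ^ Suc N \<longleftrightarrow> length v \<le> N"
proof -
  have h: "2 ^ length v \<le> heap 1 v" "heap 1 v < 2 ^ Suc (length v)"
    using heap_eq[of 1 v] heap_0_less[of v] by simp_all
  show ?thesis
  proof (cases "length v \<le> N")
    case True
    then have "(2::nat) ^ Suc (length v) \<le> 2 ^ Suc N" by (intro power_increasing) simp_all
    with h True show ?thesis by linarith
  next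
    case False
    then have "(2::nat) ^ Suc N \<le> 2 ^ length v" by (intro power_increasing) simp_all
    with h False show ?thesis by linarith
  qed
qed

lemma heap_pos: "0 < heap 1 v"
  using heap_eq[of 1 v] by simp

lemma heap_surj: "0 < n \<Longrightarrow> \<exists>v. heap 1 v = n"
proof (induction n rule: less_induct)
  case (less n)
  show ?case
  proof (cases "n = 1")
    case True
    then show ?thesis by (intro exI[of _ "[]"]) simp
  next
    case False
    then have "0 < n div 2" "n div 2 < n" using less.prems by auto
    then obtain v where "heap 1 v = n div 2" using less.IH by blast
    then show ?thesis by (intro exI[of _ "v @ [odd n]"]) (simp del: heap_simps(3))
  qed
qed

lemma heap_less_length: "length u < length v \<Longrightarrow> heap 1 u < heap 1 v"
  using heap_less_power_iff[of u "length u"] heap_less_power_iff[of v "length u"] by simp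

lemma heap_length_mono: "heap 1 u \<le> heap 1 v \<Longrightarrow> length u \<le> length v"
  using heap_less_length[of v u] by linarith

lemma heap_inj:
  assumes "heap 1 u = heap 1 v" shows "u = v"
proof -
  have "length u = length v" using heap_length_mono[of u v] heap_length_mono[of v u] assms by simp
  then show ?thesis using heap_0_inj heap_eq[of 1 u] heap_eq[of 1 v] assms by simp
qed

lemma heap_0_Cons: "heap 0 (b # v) = of_bool b * 2 ^ length v + heap 0 v"
  using heap_eq[of "of_bool b" v] by (simp add: heap_def)

lemma heap_0_less_iff:
  assumes "length u = length v"
  shows "heap 0 u < heap 0 v \<longleftrightarrow> (u, v) \<in> lex {(x, y). x < y}"
  using assms
proof (induction u v rule: list_induct2)
  case (Cons a u b v)
  have "heap 0 u < 2 ^ length v" "heap 0 v < 2 ^ length v"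
    using heap_0_less[of u] heap_0_less[of v] Cons.hyps by simp_all
  then show ?case
    using Cons by (cases a; cases b) (auto simp: heap_0_Cons)
qed simp

text \<open>Longer words have more digits, and for equal lengths numerical order is lexicographic
  order of the digits.\<close>

lemma heap_less_iff: "heap 1 u < heap 1 v \<longleftrightarrow> u < v"
proof (cases "length u = length v")
  case True
  then show ?thesis
    using heap_0_less_iff[OF True] heap_eq[of 1 u] heap_eq[of 1 v]
    by (simp add: list_less_def lenlex_conv)
next
  case False
  then show ?thesis
    using heap_less_length[of u v] heap_less_length[of v u]
    by (metis (no_types, lifting) case_prodI lenlex_conv linorder_neqE_nat list_less_def mem_Collect_eq
        order_less_asym)
qed

definition word :: "nat \<Rightarrow> bool list" where
  "word n = (THE v. heap 1 v = n)"

lemma word_heap: "word (heap 1 v) = v"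
  unfolding word_def by (rule the_equality[OF refl heap_inj])

lemma heap_word: "0 < n \<Longrightarrow> heap 1 (word n) = n"
  using heap_surj[of n] word_heap by metis

text \<open>Sorting by word is sorting by heap position, so the \<open>n\<close>-th label read
  belongs to position \<open>n\<close>. Labels never decide the order, as each word occurs
  once.\<close>

lemma sorted_training_data:
  "sorted_list_of_set (training_data N f) = map (\<lambda>n. (word n, f (word n))) [1..<2 ^ Suc N]"
    (is "_ = map ?e ?ns")
proof -
  have less: "?e m < ?e n" if "0 < m" "m < n" for m n
    using that heap_less_iff[of "word m" "word n"] heap_word[of m] heap_word[of n] by simp
  have "sorted_wrt (<) (map ?e ?ns)"
    unfolding sorted_wrt_map
    by (rule sorted_wrt_mono_rel[OF _ sorted_wrt_upt], rule less) simp_all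
  moreover have "set (map ?e ?ns) = training_data N f"
  proof (intro equalityI subsetI)
    fix e assume "e \<in> set (map ?e ?ns)"
    then obtain n where "e = ?e n" "0 < n" "n < 2 ^ Suc N" by auto
    then show "e \<in> training_data N f"
      using heap_less_power_iff[of "word n" N] heap_word[of n] by (simp add: training_data_def)
  next
    fix e assume "e \<in> training_data N f"
    then obtain x where x: "e = (x, f x)" "length x \<le> N" unfolding training_data_def by blast
    then have "heap 1 x \<in> set ?ns"
      using heap_less_power_iff[of x N] heap_pos[of x] by (simp add: Suc_le_eq)
    moreover have "e = ?e (heap 1 x)" by (simp only: x(1) word_heap)
    ultimately show "e \<in> set (map ?e ?ns)" unfolding set_map by (rule rev_image_eqI)
  qed
  ultimately show ?thesis
    using sorted_list_of_set.idem_if_sorted_distinct[of "map ?e ?ns"]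
    unfolding strict_sorted_iff by simp
qed

section \<open>The learned automaton\<close>

definition label_table :: "nat \<Rightarrow> (bool list \<Rightarrow> bool) \<Rightarrow> nat list" where
  "label_table N f = bits (map (\<lambda>n. f (word n)) [1..<2 ^ Suc N])"

text \<open>State \<open>q\<close> stands for the word at heap position \<open>q + 1\<close>.\<close>

definition learned :: "nat \<Rightarrow> (bool list \<Rightarrow> bool) \<Rightarrow> dfa" where
  "learned N f = \<lparr>num_states = 2 ^ Suc N - 1, start = 0,
     delta = (\<lambda>q b. rep (label_table N f) (2 * Suc q + of_bool b) - 1),
     final = {q. q < 2 ^ Suc N - 1 \<and> f (word (Suc q))}\<rparr>"

lemma length_label_table [simp]: "length (label_table N f) = 2 ^ Suc N - 1"
  by (simp add: label_table_def bits_def)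

lemma sym_label_table:
  "0 < n \<Longrightarrow> n < 2 ^ Suc N \<Longrightarrow> sym (label_table N f) n = (if f (word n) then 2 else 1)"
  by (auto simp: sym_def label_table_def bits_def simp del: power_Suc)

lemma sym_label_table_heap:
  assumes "length u \<le> N"
  shows "sym (label_table N f) (heap 1 u) = (if f u then 2 else 1)"
proof -
  have "heap 1 u < 2 ^ Suc N"
    using assms heap_less_power_iff by blast
  then show ?thesis using sym_label_table[OF heap_pos] by (simp only: word_heap)
qed

lemma halts_with_learned:
  "halts_with (machine 10 learner) (encode_sample (training_data N f))
     (bits (encode_dfa (learned N f)))"
proof -
  let ?M = "2 ^ Suc N - 1 :: nat"
  let ?es = "map (\<lambda>n. (word n, f (word n))) [1..<2 ^ Suc N]"
  let ?T = "label_table N f"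
  let ?D = "learned N f"
  have sample: "encode_sample (training_data N f) = concat (map encode_entry ?es)"
    by (simp only: encode_sample_def sorted_training_data encode_entry_def[abs_def] case_prod_unfold)
  have T: "bits (map snd ?es) = ?T"
    by (simp add: label_table_def comp_def)
  have len: "length ?es = ?M" by simp
  have bits_append: "bits (u @ v) = bits u @ bits v" for u v by (simp add: bits_def)
  have "state_code ?T (Suc q) = bits (encode_state ?D q)" if "q < ?M" for q
  proof -
    have "sym ?T (Suc q) = (if f (word (Suc q)) then 2 else 1)"
      using that by (intro sym_label_table) linarith+
    moreover have "q \<in> final ?D \<longleftrightarrow> f (word (Suc q))"
      using that by (simp add: learned_def)
    ultimately have "[sym ?T (Suc q)] = bits [q \<in> final ?D]"
      by (simp add: bits_def)
    moreover have "delta ?D q b = rep ?T (2 * Suc q + of_bool b) - 1" for b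
      by (simp add: learned_def)
    ultimately show ?thesis
      by (simp add: state_code_def encode_state_def bits_append)
  qed
  then have "map (state_code ?T) [1..<Suc ?M] = map (\<lambda>q. bits (encode_state ?D q)) [0..<?M]"
    unfolding One_nat_def map_Suc_upt[symmetric] by (simp del: upt_Suc power_Suc)
  moreover have "bits (concat us) = concat (map bits us)" for us
    by (induction us) (simp_all add: bits_def)
  moreover have "num_states ?D = ?M" "start ?D = 0" by (simp_all add: learned_def)
  ultimately have "bits (unary (length ?es)) @ bits (unary 0) @
      concat (map (state_code ?T) [1..<Suc (length ?es)]) = bits (encode_dfa ?D)"
    unfolding len by (simp add: encode_dfa_def bits_append comp_def del: upt_Suc power_Suc)
  then show ?thesis
    using halts_with_learner[of ?es] unfolding sample T by simp
qed

lemma bits_inject: "bits p = bits q \<Longrightarrow> p = q"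
  unfolding bits_def by (rule injD[OF inj_mapI]) (auto simp: inj_def split: if_splits)

lemma learn_learner:
  "learn (machine 10 learner) (training_data N f) = encode_dfa (learned N f)"
  unfolding learn_def using halts_with_learned halts_with_unique bits_inject
  by (intro the_equality) blast+

lemma learning_algorithm_learner: "learning_algorithm (machine 10 learner)"
  unfolding learning_algorithm_def using is_tm_machine[OF safe_learner] halts_with_learned by auto

section \<open>Correctness of the learned automaton\<close>

lemma agree_iff:
  assumes "length x \<le> length y"
  shows "agree (label_table N f) (heap 1 x) (heap 1 y) \<longleftrightarrow>
    (\<forall>v. length y + length v \<le> N \<longrightarrow> f (x @ v) = f (y @ v))"
proof -
  let ?T = "label_table N f"
  \<comment> \<open>The left end of level \<open>l\<close> below \<open>y\<close> is the word
    \<open>y\<close> followed by \<open>l\<close> times \<open>False\<close>.\<close>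
  have in_table: "heap 1 y * 2 ^ l \<le> length ?T \<longleftrightarrow> length y + l \<le> N" for l
  proof -
    have "heap 0 (replicate l False) = 0" by (induction l) (simp_all add: heap_0_Cons)
    then have "heap 1 y * 2 ^ l = heap 1 (y @ replicate l False)"
      using heap_eq[of "heap 1 y" "replicate l False"] by simp
    then have "heap 1 y * 2 ^ l < 2 ^ Suc N \<longleftrightarrow> length y + l \<le> N"
      using heap_less_power_iff[of "y @ replicate l False" N] by simp
    moreover have "(0::nat) < 2 ^ Suc N" by simp
    ultimately show ?thesis unfolding length_label_table by linarith
  qed
  have ext: "heap 1 u * 2 ^ length v + heap 0 v = heap 1 (u @ v)" for u v
    using heap_eq[of "heap 1 u" v] by simp
  have eq: "sym ?T (heap 1 (x @ v)) = sym ?T (heap 1 (y @ v)) \<longleftrightarrow> f (x @ v) = f (y @ v)"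
    if "length y + length v \<le> N" for v
  proof -
    \<comment> \<open>As \<open>x\<close> is not longer than \<open>y\<close>, both extended words
      are in the data.\<close>
    have "length (x @ v) \<le> N" "length (y @ v) \<le> N" using that assms by simp_all
    then show ?thesis by (simp only: sym_label_table_heap) simp
  qed
  have "agree ?T (heap 1 x) (heap 1 y) \<longleftrightarrow> (\<forall>v. length y + length v \<le> N \<longrightarrow>
      sym ?T (heap 1 (x @ v)) = sym ?T (heap 1 (y @ v)))"
    unfolding agree_def in_table using ext heap_0_less heap_0_surj by metis
  then show ?thesis using eq by blast
qed

lemma is_dfa_learned: "is_dfa (learned N f)"
proof -
  have "rep (label_table N f) m \<le> 2 ^ Suc N - 1" if "0 < m" for m
  proof (cases "m \<le> 2 ^ Suc N - 1")
    case True
    then show ?thesis using rep(3)[OF that, of "label_table N f"] by linarith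
  next
    case False
    have "m \<le> m * 2 ^ l" for l by simp
    with False have "\<not> m * 2 ^ l \<le> 2 ^ Suc N - 1" for l
      using order.trans by blast
    \<comment> \<open>For a position outside the data, such as a successor of a word of length
      \<open>N\<close>, nothing is tested, and the first candidate, the empty word, is
      taken.\<close>
    then have "agree (label_table N f) 1 m"
      unfolding agree_def length_label_table by blast
    then have "rep (label_table N f) m \<le> 1"
      unfolding rep_def by (intro Least_le) simp
    also have "(1::nat) \<le> 2 ^ Suc N - 1" by (induction N) auto
    finally show ?thesis .
  qed
  moreover have "0 < rep (label_table N f) m" if "0 < m" for m using rep(1) that .
  ultimately have *: "rep (label_table N f) m - 1 < 2 ^ Suc N - 1" if "0 < m" for m
    using that by (metis Suc_pred' less_eq_Suc_le One_nat_def)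
  have "rep (label_table N f) (2 * Suc q + of_bool b) - 1 < 2 ^ Suc N - 1" for q b
    by (rule *) simp
  moreover have "(0::nat) < 2 ^ Suc N - 1" by (induction N) auto
  ultimately show ?thesis
    unfolding is_dfa_def learned_def dfa.simps by blast
qed

lemma accepts_learned:
  assumes B: "is_dfa B" and N: "2 * num_states B - 2 \<le> N"
  shows "accepts (learned N (accepts B)) = accepts B"
proof
  fix x
  let ?c = "num_states B" and ?f = "accepts B"
  let ?T = "label_table N ?f" and ?D = "learned N ?f"
  let ?run = "foldl (delta B) (start B)"
  have c: "0 < ?c" using B by (auto simp: is_dfa_def)
  have run: "?run u < ?c" for u
    using B by (induction u rule: rev_induct) (simp_all add: is_dfa_def)
  have f: "?f (u @ v) \<longleftrightarrow> foldl (delta B) (?run u) v \<in> final B" for u v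
    by (simp add: accepts_def)
  \<comment> \<open>The invariant of a run is Nerode equivalence of the state reached to the word
    read; the bound on its length keeps the necessary tests within the data.\<close>
  have "\<exists>u. Suc (foldl (delta ?D) (start ?D) x) = heap 1 u \<and> length u < ?c \<and>
      (\<forall>v. ?f (u @ v) = ?f (x @ v))"
  proof (induction x rule: rev_induct)
    case Nil
    show ?case using c by (intro exI[of _ "[]"]) (simp add: learned_def)
  next
    case (snoc b x)
    then obtain u where u: "Suc (foldl (delta ?D) (start ?D) x) = heap 1 u" "length u < ?c"
      "\<And>v. ?f (u @ v) = ?f (x @ v)" by blast
    let ?y = "u @ [b]"
    let ?m = "heap 1 ?y"
    have m: "0 < ?m" by (rule heap_pos)
    obtain z where z: "heap 1 z = rep ?T ?m" using heap_surj rep(1)[OF m] by blast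
    have state: "Suc (foldl (delta ?D) (start ?D) (x @ [b])) = heap 1 z"
    proof -
      have "delta ?D q b = rep ?T (2 * Suc q + of_bool b) - 1" for q
        by (simp add: learned_def)
      then have "foldl (delta ?D) (start ?D) (x @ [b]) = rep ?T ?m - 1"
        by (simp only: foldl_append foldl.simps u(1) heap_simps(2))
      then show ?thesis using rep(1)[OF m, of ?T] z by linarith
    qed
    \<comment> \<open>If \<open>?y\<close> is too long to be its own witness, a short access word
      for the same state replaces it.\<close>
    obtain s where s: "length s < ?c" "length s \<le> length ?y" "?run s = ?run ?y"
    proof (cases "length ?y < ?c")
      case True
      then show ?thesis using that by blast
    next
      case False
      obtain s where "length s < ?c" "?run s = ?run ?y" using short_access[OF B] by blast
      then show ?thesis using that[of s] False by simp
    qed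
    have "agree ?T (heap 1 s) ?m"
      unfolding agree_iff[OF s(2)] f s(3) by blast
    \<comment> \<open>Words reaching the same state agree, so the search stops at \<open>s\<close>
      at the latest.\<close>
    then have "heap 1 z \<le> heap 1 s"
      using rep(4)[OF m heap_pos] z by (metis not_le)
    then have len: "length z \<le> length s" by (rule heap_length_mono)
    then have "agree ?T (heap 1 z) ?m" "length z \<le> length ?y"
      using rep(2)[OF m] s(2) z by auto
    then have "\<forall>v. length ?y + length v \<le> N \<longrightarrow> ?f (z @ v) = ?f (?y @ v)"
      using agree_iff by blast
    \<comment> \<open>Here \<open>length ?y\<close> is at most \<open>?c\<close> and
      \<open>length v\<close> at most \<open>?c - 2\<close>; this is the origin of the bound
      \<open>2 * ?c - 2\<close>.\<close>
    moreover have "length ?y + length v \<le> N" if "length v + 2 \<le> ?c" for v :: "bool list"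
      using that N u(2) by simp
    ultimately have short: "?f (z @ v) = ?f (?y @ v)" if "length v + 2 \<le> ?c" for v
      using that by blast
    have "?f (z @ v) = ?f (?y @ v)" for v
      unfolding f by (rule distinguishing_length[OF B run run]) (rule short[unfolded f])
    then have "?f (z @ v) = ?f ((x @ [b]) @ v)" for v
      using u(3)[of "b # v"] by simp
    then show ?case using state len s(1) by (intro exI[of _ z]) simp
  qed
  then obtain u where u: "Suc (foldl (delta ?D) (start ?D) x) = heap 1 u" "length u < ?c"
      "\<And>v. ?f (u @ v) = ?f (x @ v)" by blast
  \<comment> \<open>The state reached lies in the data, so its acceptance bit is the true label of
    \<open>u\<close>.\<close>
  have "length u \<le> N" using u(2) N c by linarith
  then have "heap 1 u < 2 ^ Suc N" using heap_less_power_iff by blast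
  then have "foldl (delta ?D) (start ?D) x < 2 ^ Suc N - 1"
    unfolding u(1)[symmetric] by linarith
  moreover have "q \<in> final ?D \<longleftrightarrow> q < 2 ^ Suc N - 1 \<and> ?f (word (Suc q))" for q
    by (simp add: learned_def)
  ultimately have "accepts ?D x \<longleftrightarrow> ?f u"
    unfolding accepts_def[of ?D] by (simp only: u(1) word_heap simp_thms)
  then show "accepts ?D x \<longleftrightarrow> ?f x" using u(3)[of "[]"] by simp
qed

lemma learner_correct:
  assumes "f \<in> function_class R_DFA" and "2 * complexity R_DFA C_DFA f - 2 \<le> N"
  shows "R_DFA (learn (machine 10 learner) (training_data N f)) = f"
proof -
  have "\<exists>n M. is_dfa M \<and> accepts M = f \<and> num_states M = n"
    using assms(1) unfolding function_class_DFA by blast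
  from LeastI_ex[OF this] obtain B where "is_dfa B" "f = accepts B"
    "num_states B = complexity R_DFA C_DFA f"
    unfolding complexity_DFA by blast
  then show ?thesis
    using assms(2) accepts_learned[of B N] by (simp add: learn_learner R_DFA_encode is_dfa_learned)
qed

section \<open>A computable bound\<close>

definition unary_double :: prog where
  "unary_double = While (\<lambda>rs. rs ! 0 \<noteq> 0)
     (Act (\<lambda>rs j. if j = 0 then (rs ! 0, Stay) else (2, Rgt)) ;; Act (\<lambda>rs j. (2, Rgt)))"

text \<open>The computable bound only has to dominate \<open>2 * c - 2\<close>, so plain doubling is
  enough: each input symbol is answered by two output symbols.\<close>

lemma computable_double: "computable_nat (\<lambda>n. 2 * n)"
proof -
  have "halts_with (machine 2 unary_double) (bits (replicate n True)) (bits (replicate (2 * n) True))"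
    for n
  proof -
    let ?w = "replicate n 2 :: nat list"
    define S :: "nat \<Rightarrow> nat \<Rightarrow> store" where
      "S i k = (\<lambda>j. if j = 0 then (int i, cells ?w)
        else if j = 1 then (int k, cells (replicate k 2)) else blank_tape)" for i k
    have S: "S i k j = (if j = 0 then (int i, cells ?w)
        else if j = 1 then (int k, cells (replicate k 2)) else blank_tape)" for i k j
      by (simp add: S_def)
    have cells: "(cells (replicate k 2))(int k := 2) = cells (replicate (Suc k) 2)" for k
      using cells_append[of "replicate k 2" 2] by (simp add: replicate_append_same)
    have reads: "reads 2 (S i k) ! 0 = (if i < n then 2 else 0)" for i k
      by (simp add: reads_def S_def cells_def)
    \<comment> \<open>The second action writes \<open>2\<close> on the input tape as well, where a
      \<open>2\<close> stands already.\<close>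
    have keep: "i < n \<Longrightarrow> (cells ?w)(int i := 2) = cells ?w" for i
      by (auto simp: cells_def)
    have 1: "exec 2 (Act (\<lambda>rs j. if j = 0 then (rs ! 0, Stay) else (2, Rgt))) (S i k) (S i (Suc k))"
      if "i < n" for i k
      by (rule exec_ActI, rule ext) (use that in \<open>auto simp: perform_eq reads S keep cells\<close>)
    have 2: "exec 2 (Act (\<lambda>rs j. (2, Rgt))) (S i k) (S (Suc i) (Suc k))" if "i < n" for i k
      by (rule exec_ActI, rule ext) (use that in \<open>auto simp: perform_eq S keep cells\<close>)
    have "exec 2 unary_double (init_store ?w) (S n (2 * n))"
      unfolding unary_double_def
    proof (rule exec_While_seq[where S = "\<lambda>i. S i (2 * i)" and n = n])
      show "init_store ?w = S 0 (2 * 0)"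
        by (rule ext) (simp add: init_store_def S input_tape_def cells_def[abs_def] blank_tape_def)
      fix i assume "i < n"
      from exec.Seq[OF 1[OF this] 2[OF this], of "2 * i"]
      show "exec 2 (Act (\<lambda>rs j. if j = 0 then (rs ! 0, Stay) else (2, Rgt)) ;; Act (\<lambda>rs j. (2, Rgt)))
          (S i (2 * i)) (S (Suc i) (2 * Suc i))" by simp
    qed (simp_all add: reads)
    moreover have "holds_word (S n (2 * n) (2 - 1)) (replicate (2 * n) 2)"
      by (simp add: S_def holds_word_def cells_def)
    ultimately show ?thesis
      using halts_with_machine[of 2 unary_double] by (simp add: bits_def)
  qed
  moreover have "is_tm (machine 2 unary_double)"
    by (rule is_tm_machine) (simp_all add: unary_double_def nth_less_syms)
  ultimately show ?thesis unfolding computable_nat_def by blast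
qed

theorem proposition3p10:
  shows "nonasymptotic_length_generalization R_DFA C_DFA \<and>
    (\<exists>A. learning_algorithm A \<and>
      (\<forall>c::nat. c \<ge> 1 \<longrightarrow> gen_length_upto R_DFA C_DFA A c \<le> enat (2 * c - 2)))"
proof
  let ?A = "machine 10 learner"
  show "nonasymptotic_length_generalization R_DFA C_DFA"
    unfolding nonasymptotic_length_generalization_def
    using learning_algorithm_learner computable_double learner_correct
    by (intro exI[of _ ?A] exI[of _ "\<lambda>n. 2 * n"]) auto
  have "gen_length R_DFA ?A f \<le> enat (2 * c - 2)"
    if "f \<in> function_class R_DFA" "complexity R_DFA C_DFA f \<le> c" for f c
  proof -
    have "\<forall>n \<ge> 2 * c - 2. R_DFA (learn ?A (training_data n f)) = f"
      using learner_correct[OF that(1)] that(2) by auto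
    then show ?thesis
      unfolding gen_length_def by (intro Inf_lower) blast
  qed
  then have "gen_length_upto R_DFA C_DFA ?A c \<le> enat (2 * c - 2)" for c
    unfolding gen_length_upto_def by (intro Sup_least) blast
  then show "\<exists>A. learning_algorithm A \<and>
      (\<forall>c::nat. c \<ge> 1 \<longrightarrow> gen_length_upto R_DFA C_DFA A c \<le> enat (2 * c - 2))"
    using learning_algorithm_learner by blast
qed

end
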